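(* Let $\xi\stackrel{d}{=}\sum_kW_k\delta_{U_k}$ be a unitary random measure with total mass $T_\xi=\xi(\mathbb{U})$, and let $\mathbf{Z}$ be a random binary matrix generated from $\xi$ by $\mathbf{Z}_{1k},\ldots,\mathbf{Z}_{nk}\,|\,(W_j)\sim_{\mathrm{iid}}\mathrm{Bernoulli}(W_k)$, independently over columns $k$. Let $\Sigma_i:=\sum_k\mathbf{Z}_{ik}$ be the sum of the $i$th row. Suppose $\Sigma_i$ is approximated by a Poisson variable with mean $T_\xi$, and measure the approximation error as $$E_\xi:=d_{\mathrm{TV}}\bigl(\mathcal{L}(\Sigma_i\,|\,\xi),\,\mathrm{Poisson}(T_\xi)\bigr).$$ Then $E_\xi\,|\,\xi<\sum_kW_k^2$, and the expected error is bounded as $$\mathbb{E}[E_\xi]<\mathbb{E}[T_\xi\tilde W_1],$$ where $(\tilde W_1,\tilde W_2,\ldots)$ is a size-biased permutation of the weight sequence $(W_k)$.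
   Context: A discrete random measure $\xi=\sum_kW_k\delta_{U_k}$ on a space $\mathbb{U}$ is unitary if almost surely $W_1,W_2,\ldots\in[0,1]$ and $\xi(\mathbb{U})<\infty$; here $T_\xi>0$ a.s. $d_{\mathrm{TV}}(P,Q)=\sup_A|P(A)-Q(A)|$ is total variation distance. In a size-biased permutation the first element satisfies $\mathbb{P}(\tilde W_1=W_k\,|\,(W_j))=W_k/T_\xi$ (summed over ties). *)

theory Defs
  imports "HOL-Probability.Probability"
begin

section \<open>Random measures\<close>

text \<open>The \<sigma>-algebra on the set of all measures on \<open>S\<close> generated by the evaluations
  \<open>m \<mapsto> m(B)\<close>.  This is the analogue of \<^const>\<open>subprob_algebra\<close> without a bound on the total mass.\<close>

definition measure_algebra :: "'u measure \<Rightarrow> 'u measure measure" where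
  "measure_algebra S =
     (SUP B\<in>sets S. vimage_algebra {m. sets m = sets S} (\<lambda>m. emeasure m B) borel)"

definition point_mass_sum :: "(nat \<Rightarrow> real) \<Rightarrow> (nat \<Rightarrow> 'u::topological_space) \<Rightarrow> 'u measure" where
  "point_mass_sum w u =
     measure_of UNIV (sets borel) (\<lambda>B. \<Sum>k. ennreal (w k) * indicator B (u k))"

lemma emeasure_point_mass_sum:
  assumes "B \<in> sets borel"
  shows "emeasure (point_mass_sum w u) B = (\<Sum>k. ennreal (w k) * indicator B (u k))"
proof (rule emeasure_measure_of[OF point_mass_sum_def])
  show "sets borel \<subseteq> Pow UNIV"
    by simp
  show "B \<in> sets (point_mass_sum w u)"
    using assms by (simp add: point_mass_sum_def sets_measure_of sets.sigma_sets_eq[of borel, simplified])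
  show "positive (sets (point_mass_sum w u)) (\<lambda>B. \<Sum>k. ennreal (w k) * indicator B (u k))"
    by (simp add: positive_def)
  show "countably_additive (sets (point_mass_sum w u)) (\<lambda>B. \<Sum>k. ennreal (w k) * indicator B (u k))"
  proof (rule countably_additiveI)
    fix A :: "nat \<Rightarrow> 'a set"
    assume "disjoint_family A"
    then have "(\<Sum>i. indicator (A i) (u k)) = (indicator (\<Union>i. A i) (u k) :: ennreal)" for k
      by (rule suminf_indicator)
    then have *: "(\<Sum>i. ennreal (w k) * indicator (A i) (u k)) = ennreal (w k) * indicator (\<Union>i. A i) (u k)" for k
      by simp
    have "(\<Sum>i. \<Sum>k. ennreal (w k) * indicator (A i) (u k))
        = (\<Sum>k. \<Sum>i. ennreal (w k) * indicator (A i) (u k))"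
      unfolding nn_integral_count_space_nat[symmetric]
      by (rule nn_integral_fst_count_space[unfolded nn_integral_snd_count_space[symmetric], of "\<lambda>(i,k). ennreal (w k) * indicator (A i) (u k)", simplified])
    then show "(\<Sum>i. \<Sum>k. ennreal (w k) * indicator (A i) (u k))
        = (\<Sum>k. ennreal (w k) * indicator (\<Union>i. A i) (u k))"
      unfolding * .
  qed
qed

text \<open>Sequences with finitely many atoms are covered by taking \<open>W k = 0\<close> for the remaining \<open>k\<close>.\<close>

definition unitary_random_measure ::
  "'a measure \<Rightarrow> ('a \<Rightarrow> 'u::topological_space measure) \<Rightarrow> (nat \<Rightarrow> 'a \<Rightarrow> real) \<Rightarrow> (nat \<Rightarrow> 'a \<Rightarrow> 'u) \<Rightarrow> bool"
where
  "unitary_random_measure M \<xi> W U \<longleftrightarrow>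
     \<xi> \<in> M \<rightarrow>\<^sub>M measure_algebra borel \<and>
     (\<forall>k. W k \<in> M \<rightarrow>\<^sub>M borel) \<and> (\<forall>k. U k \<in> M \<rightarrow>\<^sub>M borel) \<and>
     (AE \<omega> in M. \<xi> \<omega> = point_mass_sum (\<lambda>k. W k \<omega>) (\<lambda>k. U k \<omega>)) \<and>
     (AE \<omega> in M. \<forall>k. W k \<omega> \<in> {0..1}) \<and>
     (AE \<omega> in M. emeasure (\<xi> \<omega>) UNIV < \<infinity>) \<and>
     (AE \<omega> in M. emeasure (\<xi> \<omega>) UNIV > 0)"

definition total_mass :: "'u measure \<Rightarrow> real" where
  "total_mass m = measure m (space m)"

section \<open>Conditioning\<close>

text \<open>The \<sigma>-algebra of the random measure \<open>\<xi>\<close> itself, and that of its atoms and weights as a labelled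
  family.  Recovering the weights from \<open>\<xi>\<close> is possible only if the locations of the atoms of positive
  weight are distinct: for coinciding locations \<open>\<xi>\<close> sees only the sum of the weights.\<close>

definition sigma_measure :: "'a measure \<Rightarrow> ('a \<Rightarrow> 'u::topological_space measure) \<Rightarrow> 'a measure" where
  "sigma_measure M \<xi> = vimage_algebra (space M) \<xi> (measure_algebra borel)"

definition sigma_atoms ::
  "'a measure \<Rightarrow> (nat \<Rightarrow> 'a \<Rightarrow> real) \<Rightarrow> (nat \<Rightarrow> 'a \<Rightarrow> 'u::topological_space) \<Rightarrow> 'a measure" where
  "sigma_atoms M W U =
     vimage_algebra (space M) (\<lambda>\<omega>. \<lambda>k\<in>UNIV. (W k \<omega>, U k \<omega>)) (\<Pi>\<^sub>M k\<in>UNIV. borel \<Otimes>\<^sub>M borel)"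

text \<open>\<open>\<kappa>\<close> is a regular version of the conditional law of \<open>X\<close> given the sub-\<sigma>-algebra \<open>F\<close>.\<close>

definition regular_cond_law ::
  "'a measure \<Rightarrow> 'a measure \<Rightarrow> ('a \<Rightarrow> 'b) \<Rightarrow> 'b measure \<Rightarrow> ('a \<Rightarrow> 'b measure) \<Rightarrow> bool" where
  "regular_cond_law M F X N \<kappa> \<longleftrightarrow>
     subalgebra M F \<and> X \<in> M \<rightarrow>\<^sub>M N \<and> \<kappa> \<in> F \<rightarrow>\<^sub>M prob_algebra N \<and>
     (\<forall>A\<in>sets N. AE \<omega> in M.
        real_cond_exp M F (indicator (X -` A \<inter> space M)) \<omega> = measure (\<kappa> \<omega>) A)"

section \<open>The random binary matrix\<close>

text \<open>\<open>Z i k\<close> with \<open>i \<in> {1..n}\<close>, given the atoms and weights of \<open>\<xi>\<close>: the entries are independent and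
  \<open>Z i k\<close> is Bernoulli with parameter \<open>W k\<close>, whatever the locations are.\<close>

definition generated_matrix ::
  "'a measure \<Rightarrow> (nat \<Rightarrow> 'a \<Rightarrow> real) \<Rightarrow> (nat \<Rightarrow> 'a \<Rightarrow> 'u::topological_space) \<Rightarrow> nat \<Rightarrow>
   (nat \<Rightarrow> nat \<Rightarrow> 'a \<Rightarrow> bool) \<Rightarrow> bool" where
  "generated_matrix M W U n Z \<longleftrightarrow>
     regular_cond_law M (sigma_atoms M W U)
       (\<lambda>\<omega>. \<lambda>(i, k)\<in>{1..n} \<times> UNIV. Z i k \<omega>)
       (\<Pi>\<^sub>M p\<in>{1..n} \<times> UNIV. count_space UNIV)
       (\<lambda>\<omega>. \<Pi>\<^sub>M p\<in>{1..n} \<times> UNIV. measure_pmf (bernoulli_pmf (W (snd p) \<omega>)))"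

text \<open>Under the hypotheses above a row has almost surely finitely many entries equal to 1;
  off this event the series below has an unspecified (constant) value.\<close>

definition row_sum :: "(nat \<Rightarrow> nat \<Rightarrow> 'a \<Rightarrow> bool) \<Rightarrow> nat \<Rightarrow> 'a \<Rightarrow> nat" where
  "row_sum Z i \<omega> = (\<Sum>k. of_bool (Z i k \<omega>))"

section \<open>Total variation distance\<close>

definition tv_dist :: "'b measure \<Rightarrow> 'b measure \<Rightarrow> real" where
  "tv_dist P Q = (SUP A\<in>sets P. \<bar>measure P A - measure Q A\<bar>)"

section \<open>Size-biased permutations\<close>

definition sigma_picks ::
  "'a measure \<Rightarrow> (nat \<Rightarrow> 'a \<Rightarrow> real) \<Rightarrow> (nat \<Rightarrow> 'a \<Rightarrow> real) \<Rightarrow> nat \<Rightarrow> 'a measure" where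
  "sigma_picks M W V j =
     vimage_algebra (space M) (\<lambda>\<omega>. (\<lambda>k\<in>UNIV. W k \<omega>, \<lambda>i\<in>{..<j}. V i \<omega>))
       ((\<Pi>\<^sub>M k\<in>UNIV. borel) \<Otimes>\<^sub>M (\<Pi>\<^sub>M i\<in>{..<j}. borel))"

text \<open>The weights are sampled without replacement with probability proportional to their size:
  given \<open>W\<close> and the first \<open>j\<close> picks, the next pick is any given one of the remaining weights with
  probability that weight divided by the remaining mass.  Subtracting the picks already made from
  the sums over all weights accounts for ties.  The picks are numbered from 0, so \<open>V 0\<close> is the
  first element of the permutation.  Once all positive weights are used up, only weights 0
  remain.\<close>

definition size_biased_permutation ::
  "'a measure \<Rightarrow> (nat \<Rightarrow> 'a \<Rightarrow> real) \<Rightarrow> (nat \<Rightarrow> 'a \<Rightarrow> real) \<Rightarrow> bool" where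
  "size_biased_permutation M W V \<longleftrightarrow>
     (\<forall>j. V j \<in> M \<rightarrow>\<^sub>M borel) \<and>
     (\<forall>j. \<forall>B\<in>sets borel. AE \<omega> in M.
        (let R = (\<Sum>k. W k \<omega>) - (\<Sum>i<j. V i \<omega>) in
         if R > 0 then
           real_cond_exp M (sigma_picks M W V j) (indicator (V j -` B \<inter> space M)) \<omega> =
             ((\<Sum>k. W k \<omega> * indicator B (W k \<omega>)) - (\<Sum>i<j. V i \<omega> * indicator B (V i \<omega>))) / R
         else V j \<omega> = 0))"

end

theory Submission
  imports Defs
begin

text \<open>
  Write \<open>h(w) = w (1 - exp (- w))\<close>, the total variation distance between Bernoulli and Poisson laws
  with mean \<open>w\<close>; it satisfies \<open>h(w) < w\<^sup>2\<close> for \<open>w > 0\<close>.  Adding the columns one at a time gives the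
  one-sided estimate \<open>P(S\<^sub>N \<in> A) \<le> Poisson(t\<^sub>N)(A) + \<Sum>k<N. h(W\<^sub>k)\<close> with \<open>t\<^sub>N = \<Sum>k<N. W\<^sub>k\<close> for the
  partial row sums \<open>S\<^sub>N\<close>; a union bound over the columns \<open>k \<ge> N\<close> and \<open>N \<rightarrow> \<infinity>\<close> carry it over to the
  full row sum conditionally on the atoms, and complements make it two-sided.

  To condition on \<open>\<xi>\<close> alone it suffices that the right-hand side is a functional of \<open>\<xi>\<close> up to null
  sets.  When the atoms have distinct locations, \<open>\<Sum>k. h(W\<^sub>k)\<close> is the integral of
  \<open>1 - exp (- \<xi>{x})\<close> with respect to \<open>\<xi>(dx)\<close>, which is measurable because the diagonal of a
  second countable Hausdorff space is measurable.

  The size-biased pick satisfies \<open>E[T g(V\<^sub>0)] = E[\<Sum>k. W\<^sub>k g(W\<^sub>k)]\<close>, so \<open>E[T V\<^sub>0]\<close> is the mean of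
  \<open>\<Sum>k. (W\<^sub>k)\<^sup>2\<close>.  The pointwise inequality being strict and the error bounded by 1, the inequality of
  the means is strict even if the right-hand side is infinite.
\<close>

section \<open>The one-sided Le Cam estimate\<close>

text \<open>At \<open>t = 0\<close> the convention \<open>0 ^ 0 = 1\<close> makes this the point
  mass at 0, so an empty or vanishing sum of weights is covered; agreement with
  \<open>poisson_pmf\<close> is established for positive rates. Over an infinite \<open>A\<close>
  the sum defaults to 0, so the estimates are made on finite sets.\<close>

definition poisson_weight :: "real \<Rightarrow> nat set \<Rightarrow> real" where
  "poisson_weight t A = (\<Sum>n\<in>A. t ^ n / fact n * exp (- t))"

lemma poisson_weight_nonneg: "0 \<le> t \<Longrightarrow> 0 \<le> poisson_weight t A"
  unfolding poisson_weight_def by (intro sum_nonneg) simp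

lemma measure_poisson_pmf:
  assumes "0 < t" "finite A"
  shows "measure_pmf.prob (poisson_pmf t) A = poisson_weight t A"
  using assms by (simp add: measure_measure_pmf_finite poisson_weight_def)

lemma poisson_weight_le_1:
  assumes "0 \<le> t" "finite A"
  shows "poisson_weight t A \<le> 1"
proof (cases "t = 0")
  case True
  then have "poisson_weight t A = (\<Sum>n\<in>A. if n = 0 then 1 else 0)"
    unfolding poisson_weight_def by (intro sum.cong) auto
  also have "\<dots> \<le> 1"
    using assms by (simp add: sum.delta)
  finally show ?thesis .
next
  case False
  with assms have "poisson_weight t A = measure_pmf.prob (poisson_pmf t) A"
    by (simp add: measure_poisson_pmf)
  then show ?thesis
    by simp
qed

text \<open>These are the first two terms of the binomial expansion. The induction multiplies by
  \<open>t + w\<close> and drops the nonnegative term in \<open>w\<^sup>2\<close>.\<close>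

lemma power_add_ge:
  fixes t w :: real
  assumes "0 \<le> t" "0 \<le> w"
  shows "t ^ Suc n + Suc n * w * t ^ n \<le> (t + w) ^ Suc n"
proof (induction n)
  case (Suc n)
  have "t ^ Suc (Suc n) + Suc (Suc n) * w * t ^ Suc n
      \<le> t ^ Suc (Suc n) + Suc (Suc n) * w * t ^ Suc n + Suc n * w\<^sup>2 * t ^ n"
    using assms by simp
  also have "\<dots> = (t + w) * (t ^ Suc n + Suc n * w * t ^ n)"
    by (simp add: algebra_simps power2_eq_square)
  also have "\<dots> \<le> (t + w) * (t + w) ^ Suc n"
    using assms Suc by (intro mult_left_mono) auto
  finally show ?case by simp
qed simp

text \<open>Keep only the events that the second summand of \<open>Poisson(t) + Poisson(w)\<close> is 0 or 1.\<close>

lemma poisson_weight_add_ge: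
  assumes "0 \<le> t" "0 \<le> w" "finite A"
  shows "exp (- w) * poisson_weight t A + w * exp (- w) * poisson_weight t (Suc -` A)
    \<le> poisson_weight (t + w) A"
proof -
  define p where "p n = t ^ n / fact n * exp (- t)" for n
  define p' where "p' n = (case n of 0 \<Rightarrow> 0 | Suc m \<Rightarrow> p m)" for n
  have pointwise: "exp (- w) * p n + w * exp (- w) * p' n \<le> (t + w) ^ n / fact n * exp (- (t + w))" for n
  proof (cases n)
    case 0
    then show ?thesis by (simp add: p_def p'_def mult_exp_exp)
  next
    case (Suc m)
    \<comment> \<open>The factor \<open>Suc m\<close> missing in \<open>fact m\<close> is the
      coefficient of the second binomial term.\<close>
    have fact: "t ^ m / fact m = Suc m * t ^ m / fact (Suc m)"
      by (simp del: of_nat_Suc)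
    have exp: "exp (- (t + w)) = exp (- w) * exp (- t)"
      by (simp add: mult_exp_exp)
    have "exp (- w) * p n + w * exp (- w) * p' n
        = (t ^ Suc m / fact (Suc m) + w * (t ^ m / fact m)) * (exp (- w) * exp (- t))"
      unfolding Suc p'_def p_def nat.case by (simp only: ring_distribs mult_ac)
    also have "\<dots> = (t ^ Suc m + Suc m * w * t ^ m) / fact (Suc m) * exp (- (t + w))"
      unfolding fact exp by (simp only: add_divide_distrib times_divide_eq_right mult_ac)
    also have "\<dots> \<le> (t + w) ^ n / fact n * exp (- (t + w))"
      unfolding Suc using assms by (intro mult_right_mono divide_right_mono power_add_ge) auto
    finally show ?thesis .
  qed
  have "(\<Sum>n\<in>A. p' n) = (\<Sum>n\<in>A - {0}. p' n)"
    using assms(3) by (intro sum.mono_neutral_right) (auto simp: p'_def)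
  also have "A - {0} = Suc ` (Suc -` A)"
    using not0_implies_Suc by blast
  also have "(\<Sum>n\<in>Suc ` (Suc -` A). p' n) = (\<Sum>n\<in>Suc -` A. p n)"
    by (subst sum.reindex) (auto simp: p'_def)
  finally have "poisson_weight t (Suc -` A) = (\<Sum>n\<in>A. p' n)"
    by (simp add: poisson_weight_def p_def)
  then have "exp (- w) * poisson_weight t A + w * exp (- w) * poisson_weight t (Suc -` A)
     = (\<Sum>n\<in>A. exp (- w) * p n + w * exp (- w) * p' n)"
    by (simp add: poisson_weight_def p_def sum.distrib sum_distrib_left)
  also have "\<dots> \<le> poisson_weight (t + w) A"
    unfolding poisson_weight_def by (intro sum_mono pointwise)
  finally show ?thesis .
qed

text \<open>For a Bernoulli law with mean \<open>w\<close> only the mass at 1 can exceed that of the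
  Poisson law with mean \<open>w\<close>; this is the excess
  \<open>w - w * exp (- w)\<close>.\<close>

definition le_cam_gap :: "real \<Rightarrow> real" where
  "le_cam_gap w = w * (1 - exp (- w))"

lemma le_cam_gap_nonneg: "0 \<le> w \<Longrightarrow> 0 \<le> le_cam_gap w"
  by (simp add: le_cam_gap_def)

lemma le_cam_gap_le: "0 \<le> w \<Longrightarrow> le_cam_gap w \<le> w"
  by (simp add: le_cam_gap_def mult_left_le)

lemma le_cam_gap_le_square: "0 \<le> w \<Longrightarrow> le_cam_gap w \<le> w\<^sup>2"
  using exp_ge_add_one_self[of "- w"]
  by (auto simp: le_cam_gap_def power2_eq_square intro!: mult_left_mono)

text \<open>The strict inequality \<open>1 - w < exp (- w)\<close> away from 0 is what makes both
  inequalities of the theorem strict.\<close>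

lemma le_cam_gap_less_square:
  assumes "0 < w"
  shows "le_cam_gap w < w\<^sup>2"
proof -
  have "1 + - w < exp (- w)"
    using exp_minus_greater[of w] assms by simp
  then show ?thesis
    using assms by (simp add: le_cam_gap_def power2_eq_square)
qed

lemma le_cam_gap_measurable [measurable]: "le_cam_gap \<in> borel_measurable borel"
  unfolding le_cam_gap_def by measurable

text \<open>Induction on the number of columns. \<open>P N\<close> stands for the law of the sum of
  the first \<open>N\<close> entries, and \<open>step\<close> conditions on whether the next entry
  is 0 or 1. Replacing that entry by a Poisson variable of the same mean costs at most its
  gap.\<close>

lemma one_sided_le_cam:
  fixes P :: "nat \<Rightarrow> nat set \<Rightarrow> real"
  assumes zero: "\<And>A. finite A \<Longrightarrow> P 0 A \<le> poisson_weight 0 A"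
    and step: "\<And>N A. finite A \<Longrightarrow> P (Suc N) A = (1 - w N) * P N A + w N * P N (Suc -` A)"
    and w: "\<And>k. w k \<in> {0..1}"
    and "finite A"
  shows "P N A \<le> poisson_weight (\<Sum>k<N. w k) A + (\<Sum>k<N. le_cam_gap (w k))"
  using \<open>finite A\<close>
proof (induction N arbitrary: A)
  case 0
  then show ?case using zero by simp
next
  case (Suc N)
  define t where "t = (\<Sum>k<N. w k)"
  define g where "g = (\<Sum>k<N. le_cam_gap (w k))"
  define v where "v = w N"
  have v: "0 \<le> v" "v \<le> 1" and t: "0 \<le> t"
    using w by (auto simp: v_def t_def intro!: sum_nonneg)
  have fin: "finite (Suc -` A)"
    using Suc.prems by (simp add: finite_vimageI)
  let ?q = "poisson_weight t"
  have "P (Suc N) A = (1 - v) * P N A + v * P N (Suc -` A)"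
    using step Suc.prems by (simp add: v_def)
  also have "\<dots> \<le> (1 - v) * (?q A + g) + v * (?q (Suc -` A) + g)"
    using Suc.IH[OF Suc.prems] Suc.IH[OF fin] v
    by (intro add_mono mult_left_mono) (auto simp: t_def g_def)
  also have "\<dots> = (1 - v) * ?q A + v * ?q (Suc -` A) + g"
    by (simp add: algebra_simps)
  \<comment> \<open>The Poisson mass at 0 is at least \<open>1 - v\<close>, so only the mass at 1 is
    lost; the loss is the gap times a probability.\<close>
  also have "\<dots> \<le> (exp (- v) * ?q A + v * exp (- v) * ?q (Suc -` A)) + le_cam_gap v + g"
  proof -
    have "(1 - v) * ?q A \<le> exp (- v) * ?q A"
      using exp_ge_add_one_self[of "- v"] poisson_weight_nonneg[OF t] by (intro mult_right_mono) auto
    moreover have "le_cam_gap v * ?q (Suc -` A) \<le> le_cam_gap v"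
      using poisson_weight_le_1[OF t fin] le_cam_gap_nonneg[OF v(1)] by (intro mult_left_le) auto
    ultimately show ?thesis
      by (simp add: le_cam_gap_def algebra_simps)
  qed
  also have "\<dots> \<le> poisson_weight (t + v) A + le_cam_gap v + g"
    using poisson_weight_add_ge[OF t v(1) Suc.prems] by simp
  finally show ?case
    by (simp add: t_def g_def v_def)
qed

section \<open>Total variation distance of laws on the natural numbers\<close>

text \<open>Every set is exhausted by its finite initial segments and both measures are continuous
  from below. The finite sets being countably many, the distance between random laws becomes a
  countable supremum of measurable functions.\<close>

lemma tv_dist_eq_finite_SUP:
  fixes P Q :: "nat measure"
  assumes "prob_space P" "prob_space Q" "sets P = UNIV" "sets Q = UNIV"
  shows "tv_dist P Q = (SUP A\<in>{A. finite A}. \<bar>measure P A - measure Q A\<bar>)"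
proof -
  interpret P: prob_space P by fact
  interpret Q: prob_space Q by fact
  let ?d = "\<lambda>A. \<bar>measure P A - measure Q A\<bar>"
  have "?d A \<le> 1" for A
    using P.prob_le_1[of A] Q.prob_le_1[of A] measure_nonneg[of P A] measure_nonneg[of Q A] by linarith
  then have bdd: "bdd_above (?d ` S)" for S
    by (intro bdd_aboveI2[where M = 1]) auto
  show ?thesis
    unfolding tv_dist_def assms(3)
  proof (rule antisym)
    show "(SUP A\<in>{A. finite A}. ?d A) \<le> (SUP A\<in>UNIV. ?d A)"
      by (intro cSUP_subset_mono bdd) auto
    show "(SUP A\<in>UNIV. ?d A) \<le> (SUP A\<in>{A. finite A}. ?d A)"
    proof (rule cSUP_least)
      fix A :: "nat set"
      have A: "(\<Union>n. A \<inter> {..<n}) = A" by auto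
      have "(\<lambda>n. measure P (A \<inter> {..<n})) \<longlonglongrightarrow> measure P (\<Union>n. A \<inter> {..<n})"
        by (rule P.finite_Lim_measure_incseq) (auto simp: assms incseq_def)
      moreover have "(\<lambda>n. measure Q (A \<inter> {..<n})) \<longlonglongrightarrow> measure Q (\<Union>n. A \<inter> {..<n})"
        by (rule Q.finite_Lim_measure_incseq) (auto simp: assms incseq_def)
      ultimately have "(\<lambda>n. ?d (A \<inter> {..<n})) \<longlonglongrightarrow> ?d A"
        unfolding A by (intro tendsto_intros)
      then show "?d A \<le> (SUP A\<in>{A. finite A}. ?d A)"
        by (rule LIMSEQ_le_const2) (auto intro!: exI cSUP_upper bdd)
    qed simp
  qed
qed

lemma tv_dist_le_1:
  assumes "prob_space P" "prob_space Q"
  shows "tv_dist P Q \<le> 1"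
proof -
  interpret P: prob_space P by fact
  interpret Q: prob_space Q by fact
  have "\<bar>measure P A - measure Q A\<bar> \<le> 1" for A
    using P.prob_le_1[of A] Q.prob_le_1[of A] measure_nonneg[of P A] measure_nonneg[of Q A] by linarith
  moreover have "sets P \<noteq> {}"
    using sets.top[of P] by force
  ultimately show ?thesis
    unfolding tv_dist_def by (intro cSUP_least)
qed

text \<open>The bound extends from finite sets to all sets by exhaustion. Both total masses are 1,
  so the bound for \<open>- A\<close> is the reverse bound for \<open>A\<close>.\<close>

lemma tv_dist_le_of_one_sided:
  fixes P Q :: "nat measure"
  assumes "prob_space P" "prob_space Q" "sets P = UNIV" "sets Q = UNIV"
    and le: "\<And>A. finite A \<Longrightarrow> measure P A \<le> measure Q A + c"
  shows "tv_dist P Q \<le> c"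
proof -
  interpret P: prob_space P by fact
  interpret Q: prob_space Q by fact
  have space: "space P = UNIV" "space Q = UNIV"
    using sets.sets_into_space[of UNIV P] sets.sets_into_space[of UNIV Q] assms(3,4) by auto
  have le': "measure P A \<le> measure Q A + c" for A
  proof -
    have A: "(\<Union>n. A \<inter> {..<n}) = A" by auto
    have "(\<lambda>n. measure P (A \<inter> {..<n})) \<longlonglongrightarrow> measure P (\<Union>n. A \<inter> {..<n})"
      by (rule P.finite_Lim_measure_incseq) (auto simp: assms incseq_def)
    moreover have "(\<lambda>n. measure Q (A \<inter> {..<n}) + c) \<longlonglongrightarrow> measure Q (\<Union>n. A \<inter> {..<n}) + c"
      by (intro tendsto_intros Q.finite_Lim_measure_incseq) (auto simp: assms incseq_def)
    ultimately show ?thesis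
      unfolding A by (rule LIMSEQ_le) (auto intro!: exI le)
  qed
  have "\<bar>measure P A - measure Q A\<bar> \<le> c" for A
    using le'[of A] le'[of "- A"] P.prob_compl[of A] Q.prob_compl[of A]
    by (simp add: assms space Compl_eq_Diff_UNIV)
  moreover have "sets P \<noteq> {}"
    using sets.top[of P] by force
  ultimately show ?thesis
    unfolding tv_dist_def by (intro cSUP_least)
qed

section \<open>Rows of independent Bernoulli variables\<close>

abbreviation bernoulli_product :: "('b \<times> nat) set \<Rightarrow> (nat \<Rightarrow> real) \<Rightarrow> ('b \<times> nat \<Rightarrow> bool) measure" where
  "bernoulli_product I w \<equiv> (\<Pi>\<^sub>M p\<in>I. measure_pmf (bernoulli_pmf (w (snd p))))"

abbreviation partial_row_sum :: "'b \<Rightarrow> nat \<Rightarrow> ('b \<times> nat \<Rightarrow> bool) \<Rightarrow> nat" where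
  "partial_row_sum i N z \<equiv> (\<Sum>k<N. of_bool (z (i, k)))"

lemma sets_bernoulli_product:
  "sets (bernoulli_product I w) = sets (\<Pi>\<^sub>M p\<in>I. count_space UNIV)"
  by (intro sets_PiM_cong) auto

lemma bernoulli_product_prob_space: "prob_space (bernoulli_product I w)"
  by (intro prob_space_PiM) (simp add: prob_space_measure_pmf)

lemma bernoulli_product_component:
  assumes "p \<in> I" "w (snd p) \<in> {0..1}"
  shows "measure (bernoulli_product I w) {z \<in> space (bernoulli_product I w). z p} = w (snd p)"
proof -
  interpret product_prob_space "\<lambda>p. measure_pmf (bernoulli_pmf (w (snd p)))" I
    by unfold_locales
  have "emeasure (bernoulli_product I w) {z \<in> space (bernoulli_product I w). z p \<in> {True}}
      = emeasure (measure_pmf (bernoulli_pmf (w (snd p)))) {True}"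
    using assms by (intro emeasure_PiM_Collect_single) auto
  also have "\<dots> = ennreal (w (snd p))"
    using assms by (simp add: emeasure_pmf_single)
  finally show ?thesis
    using assms by (simp add: measure_def)
qed

text \<open>The vector of coordinates is the identity of the product space, so its law is the
  product of the coordinate laws, which characterises independence.\<close>

lemma bernoulli_product_indep_vars:
  assumes "I \<noteq> {}"
  shows "prob_space.indep_vars (bernoulli_product I w) (\<lambda>_. count_space UNIV) (\<lambda>p z. z p) I"
proof -
  interpret product_prob_space "\<lambda>p. measure_pmf (bernoulli_pmf (w (snd p)))" I
    by unfold_locales
  let ?P = "bernoulli_product I w"
  have rv: "(\<lambda>z. z p) \<in> ?P \<rightarrow>\<^sub>M count_space UNIV" if "p \<in> I" for p
    using measurable_component_singleton[OF that, of "\<lambda>p. measure_pmf (bernoulli_pmf (w (snd p)))"]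
    by simp
  have "distr ?P (\<Pi>\<^sub>M p\<in>I. count_space UNIV) (\<lambda>z. restrict z I) = distr ?P ?P (\<lambda>z. z)"
    by (intro distr_cong sets_bernoulli_product[symmetric])
       (auto simp: space_PiM PiE_def extensional_restrict)
  also have "\<dots> = ?P"
    by simp
  also have "?P = (\<Pi>\<^sub>M p\<in>I. distr ?P (count_space UNIV) (\<lambda>z. z p))"
  proof (intro PiM_cong refl)
    fix p assume "p \<in> I"
    then have "distr ?P (measure_pmf (bernoulli_pmf (w (snd p)))) (\<lambda>z. z p) = measure_pmf (bernoulli_pmf (w (snd p)))"
      by (rule PiM_component)
    moreover have "distr ?P (measure_pmf (bernoulli_pmf (w (snd p)))) (\<lambda>z. z p) = distr ?P (count_space UNIV) (\<lambda>z. z p)"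
      by (intro distr_cong) auto
    ultimately show "measure_pmf (bernoulli_pmf (w (snd p))) = distr ?P (count_space UNIV) (\<lambda>z. z p)"
      by simp
  qed
  finally show ?thesis
    using indep_vars_iff_distr_eq_PiM'[OF assms rv] by (simp add: restrict_def)
qed

lemma partial_row_sum_measurable:
  assumes "{i} \<times> UNIV \<subseteq> I"
  shows "partial_row_sum i N \<in> bernoulli_product I w \<rightarrow>\<^sub>M count_space UNIV"
proof -
  have "(i, k) \<in> I" for k
    using assms by auto
  then have [measurable]: "(\<lambda>z. z (i, k)) \<in> bernoulli_product I w \<rightarrow>\<^sub>M count_space UNIV" for k
    using measurable_component_singleton[of "(i, k)" I "\<lambda>p. measure_pmf (bernoulli_pmf (w (snd p)))"]
    by simp
  show ?thesis
    by measurable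
qed

text \<open>Entry \<open>N\<close> of the row is independent of the earlier ones; splitting by its
  value yields the recursion that \<open>one_sided_le_cam\<close> asks for.\<close>

lemma bernoulli_product_partial_row_sum_Suc:
  assumes I: "{i} \<times> UNIV \<subseteq> I" and w: "w N \<in> {0..1}"
  defines "P \<equiv> bernoulli_product I w"
  shows "measure P {z \<in> space P. partial_row_sum i (Suc N) z \<in> A}
      = (1 - w N) * measure P {z \<in> space P. partial_row_sum i N z \<in> A}
        + w N * measure P {z \<in> space P. partial_row_sum i N z \<in> Suc -` A}"
proof -
  interpret P: prob_space P
    unfolding P_def by (rule bernoulli_product_prob_space)
  let ?S = "partial_row_sum i"
  let ?J = "{i} \<times> {..<N}" and ?K = "{(i, N)}"
  let ?b = "\<lambda>z. of_bool (z (i, N)) :: nat"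
  have ne: "I \<noteq> {}" and iN: "(i, N) \<in> I"
    using I by auto
  have S: "?S N \<in> P \<rightarrow>\<^sub>M count_space UNIV"
    unfolding P_def by (rule partial_row_sum_measurable[OF I])
  have [measurable]: "(\<lambda>z. z (i, N)) \<in> P \<rightarrow>\<^sub>M count_space UNIV"
    using measurable_component_singleton[OF iN, of "\<lambda>p. measure_pmf (bernoulli_pmf (w (snd p)))"]
    by (simp add: P_def)
  \<comment> \<open>The entries before column \<open>N\<close> and the entry in column
    \<open>N\<close> form disjoint blocks of coordinates; functions of the two blocks are again
    independent.\<close>
  have "P.indep_var (PiM ?J (\<lambda>_. count_space UNIV)) (\<lambda>z. \<lambda>p\<in>?J. z p)
      (PiM ?K (\<lambda>_. count_space UNIV)) (\<lambda>z. \<lambda>p\<in>?K. z p)"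
    using bernoulli_product_indep_vars[OF ne, of w, folded P_def] I
    by (intro P.indep_var_restrict[of "\<lambda>_. count_space UNIV" "\<lambda>p z. z p" I]) auto
  then have "P.indep_var (count_space UNIV) (?S N \<circ> (\<lambda>z. \<lambda>p\<in>?J. z p))
      (count_space UNIV) (?b \<circ> (\<lambda>z. \<lambda>p\<in>?K. z p))"
  proof (rule P.indep_var_compose)
    have [measurable]: "(\<lambda>z. z (i, k)) \<in> PiM ?J (\<lambda>_. count_space UNIV) \<rightarrow>\<^sub>M count_space (UNIV :: bool set)" if "k \<in> {..<N}" for k
      using that by (intro measurable_component_singleton) auto
    show "?S N \<in> PiM ?J (\<lambda>_. count_space UNIV) \<rightarrow>\<^sub>M count_space UNIV"
      by measurable
    have [measurable]: "(\<lambda>z. z (i, N)) \<in> PiM ?K (\<lambda>_. count_space UNIV) \<rightarrow>\<^sub>M count_space (UNIV :: bool set)"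
      by (intro measurable_component_singleton) auto
    show "?b \<in> PiM ?K (\<lambda>_. count_space UNIV) \<rightarrow>\<^sub>M count_space UNIV"
      by measurable
  qed
  also have "?S N \<circ> (\<lambda>z. \<lambda>p\<in>?J. z p) = ?S N"
    by (intro ext) (simp del: sum_of_bool_eq cong: sum.cong_simp)
  also have "?b \<circ> (\<lambda>z. \<lambda>p\<in>?K. z p) = ?b"
    by (auto simp: fun_eq_iff)
  finally have indep: "P.indep_var (count_space UNIV) (?S N) (count_space UNIV) ?b" .
  have product: "measure P {z \<in> space P. ?S N z \<in> B \<and> ?b z \<in> C}
      = measure P {z \<in> space P. ?S N z \<in> B} * measure P {z \<in> space P. ?b z \<in> C}" for B C
    using P.indep_varD[OF indep, of B C] by (simp add: vimage_def Int_def conj_commute)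
  have ev: "{z \<in> space P. ?S N z \<in> B \<and> ?b z \<in> C} \<in> sets P" for B C
  proof -
    have b: "?b \<in> P \<rightarrow>\<^sub>M count_space UNIV"
      by measurable
    have "(?S N -` B \<inter> space P) \<inter> (?b -` C \<inter> space P) \<in> sets P"
      using sets.Int[OF measurable_sets[OF S, of B] measurable_sets[OF b, of C]] by simp
    also have "?S N -` B \<inter> space P \<inter> (?b -` C \<inter> space P) = {z \<in> space P. ?S N z \<in> B \<and> ?b z \<in> C}"
      by auto
    finally show ?thesis .
  qed
  have one: "measure P {z \<in> space P. z (i, N)} = w N"
    using bernoulli_product_component[OF iN, of w] w by (simp add: P_def)
  have zero: "measure P {z \<in> space P. \<not> z (i, N)} = 1 - w N"
    using P.prob_neg[of "\<lambda>z. z (i, N)"] one by simp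
  have eqs: "{z \<in> space P. ?b z \<in> {1}} = {z \<in> space P. z (i, N)}"
    "{z \<in> space P. ?b z \<in> {0}} = {z \<in> space P. \<not> z (i, N)}"
    by auto
  \<comment> \<open>The event is split by entry \<open>N\<close>. If that entry is 1, the earlier
    sum has to be one less than an element of \<open>A\<close>.\<close>
  define X where "X = {z \<in> space P. ?S N z \<in> A \<and> ?b z \<in> {0}}"
  define Y where "Y = {z \<in> space P. ?S N z \<in> Suc -` A \<and> ?b z \<in> {1}}"
  have "z \<in> {z \<in> space P. ?S (Suc N) z \<in> A} \<longleftrightarrow> z \<in> X \<union> Y" for z
    by (cases "z (i, N)") (simp_all add: X_def Y_def del: sum_of_bool_eq)
  then have "{z \<in> space P. ?S (Suc N) z \<in> A} = X \<union> Y"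
    by blast
  moreover have "X \<in> sets P" "Y \<in> sets P"
    unfolding X_def Y_def by (rule ev)+
  moreover have "X \<inter> Y = {}"
    by (simp add: X_def Y_def disjoint_iff)
  ultimately have "measure P {z \<in> space P. ?S (Suc N) z \<in> A} = measure P X + measure P Y"
    using P.finite_measure_Union by simp
  also have "\<dots> = (1 - w N) * measure P {z \<in> space P. ?S N z \<in> A} + w N * measure P {z \<in> space P. ?S N z \<in> Suc -` A}"
    unfolding X_def Y_def product eqs one zero by (simp only: mult.commute)
  finally show ?thesis .
qed

text \<open>Union bound over the columns from \<open>N\<close> on; the right-hand side is a tail of
  a convergent series and so vanishes as \<open>N\<close> grows.\<close>

lemma bernoulli_product_tail:
  assumes I: "{i} \<times> UNIV \<subseteq> I" and w: "\<And>k. w k \<in> {0..1}" and "summable w"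
  defines "P \<equiv> bernoulli_product I w"
  shows "measure P {z \<in> space P. \<exists>k\<ge>N. z (i, k)} \<le> (\<Sum>k. w (k + N))"
proof -
  interpret P: prob_space P
    unfolding P_def by (rule bernoulli_product_prob_space)
  have iI: "(i, k) \<in> I" for k
    using I by auto
  have [measurable]: "(\<lambda>z. z (i, k)) \<in> P \<rightarrow>\<^sub>M count_space UNIV" for k
    using measurable_component_singleton[OF iI, where M = "\<lambda>p. measure_pmf (bernoulli_pmf (w (snd p)))"]
    by (simp add: P_def)
  have one: "measure P {z \<in> space P. z (i, k + N)} = w (k + N)" for k
    using bernoulli_product_component[OF iI, of w] w by (simp add: P_def)
  have "{z \<in> space P. \<exists>k\<ge>N. z (i, k)} = (\<Union>k. {z \<in> space P. z (i, k + N)})"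
    by (auto simp: le_iff_add add.commute)
  also have "measure P \<dots> \<le> (\<Sum>k. measure P {z \<in> space P. z (i, k + N)})"
  proof (rule P.finite_measure_subadditive_countably)
    show "summable (\<lambda>k. measure P {z \<in> space P. z (i, k + N)})"
      unfolding one using \<open>summable w\<close> by (simp add: summable_iff_shift)
  qed auto
  finally show ?thesis
    by (simp add: one)
qed

text \<open>The event contains every configuration whose full row sum lies in \<open>A\<close>,
  because off the tail event the full sum is the partial one. The infinite sum therefore need not be
  evaluated on the product space.\<close>

lemma bernoulli_product_row_le:
  assumes I: "{i} \<times> UNIV \<subseteq> I" and w: "\<And>k. w k \<in> {0..1}" and "summable w" and "finite A"
  defines "P \<equiv> bernoulli_product I w"
  shows "measure P {z \<in> space P. partial_row_sum i N z \<in> A \<or> (\<exists>k\<ge>N. z (i, k))}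
    \<le> poisson_weight (\<Sum>k<N. w k) A + (\<Sum>k<N. le_cam_gap (w k)) + (\<Sum>k. w (k + N))"
proof -
  interpret P: prob_space P
    unfolding P_def by (rule bernoulli_product_prob_space)
  have "(i, k) \<in> I" for k
    using I by auto
  then have [measurable]: "(\<lambda>z. z (i, k)) \<in> P \<rightarrow>\<^sub>M count_space UNIV" for k
    using measurable_component_singleton[of "(i, k)" I "\<lambda>p. measure_pmf (bernoulli_pmf (w (snd p)))"]
    by (simp add: P_def)
  have ev: "{z \<in> space P. partial_row_sum i N z \<in> A} \<in> sets P"
    using measurable_sets[OF partial_row_sum_measurable[OF I, of N w, folded P_def], of A]
    by (simp add: vimage_def Int_def conj_commute)
  have tail: "{z \<in> space P. \<exists>k\<ge>N. z (i, k)} \<in> sets P"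
    by measurable
  have "measure P {z \<in> space P. partial_row_sum i N z \<in> A \<or> (\<exists>k\<ge>N. z (i, k))}
     = measure P ({z \<in> space P. partial_row_sum i N z \<in> A} \<union> {z \<in> space P. \<exists>k\<ge>N. z (i, k)})"
    by (intro arg_cong[where f = "measure P"]) auto
  also have "\<dots> \<le> measure P {z \<in> space P. partial_row_sum i N z \<in> A} + measure P {z \<in> space P. \<exists>k\<ge>N. z (i, k)}"
    by (rule measure_Un_le[OF ev tail])
  also have "\<dots> \<le> (poisson_weight (\<Sum>k<N. w k) A + (\<Sum>k<N. le_cam_gap (w k))) + (\<Sum>k. w (k + N))"
  proof (intro add_mono)
    show "measure P {z \<in> space P. partial_row_sum i N z \<in> A}
        \<le> poisson_weight (\<Sum>k<N. w k) A + (\<Sum>k<N. le_cam_gap (w k))"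
    proof (rule one_sided_le_cam[where P = "\<lambda>N A. measure P {z \<in> space P. partial_row_sum i N z \<in> A}"])
      fix A :: "nat set" assume "finite A"
      \<comment> \<open>Base case: the empty sum is 0 and the Poisson law of rate 0 is the point
        mass at 0.\<close>
      have "poisson_weight 0 A = (\<Sum>n\<in>A. if n = 0 then 1 else 0)"
        unfolding poisson_weight_def by (intro sum.cong) auto
      then show "measure P {z \<in> space P. partial_row_sum i 0 z \<in> A} \<le> poisson_weight 0 A"
        using \<open>finite A\<close> by (simp add: sum.delta)
    next
      fix N and A :: "nat set"
      show "measure P {z \<in> space P. partial_row_sum i (Suc N) z \<in> A}
          = (1 - w N) * measure P {z \<in> space P. partial_row_sum i N z \<in> A}
            + w N * measure P {z \<in> space P. partial_row_sum i N z \<in> Suc -` A}"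
        unfolding P_def by (rule bernoulli_product_partial_row_sum_Suc[OF I w])
    qed (use w \<open>finite A\<close> in auto)
    show "measure P {z \<in> space P. \<exists>k\<ge>N. z (i, k)} \<le> (\<Sum>k. w (k + N))"
      unfolding P_def using assms by (intro bernoulli_product_tail) auto
  qed
  finally show ?thesis .
qed

section \<open>Conditional expectations\<close>

lemma prob_space_sigma_finite_subalgebra:
  assumes "prob_space M" "subalgebra M F"
  shows "sigma_finite_subalgebra M F"
  using assms prob_space_def finite_measure_subalgebra.intro finite_measure_subalgebra_axioms.intro
    finite_measure_subalgebra_is_sigma_finite by blast

text \<open>A \<open>G\<close>-measurable upper bound survives conditioning on less information: the
  \<open>G\<close>-set where it fails turns out to be null. Containment of \<open>G\<close> in
  \<open>F\<close> is asked for only up to null sets, since a random measure equals its sum of point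
  masses only almost surely.\<close>

lemma cond_exp_upper_bound_transfer:
  fixes h :: "'a \<Rightarrow> real"
  assumes "prob_space M" and F: "subalgebra M F" and G: "subalgebra M G"
    and GF: "\<And>B. B \<in> sets G \<Longrightarrow> \<exists>B'\<in>sets F. AE \<omega> in M. \<omega> \<in> B \<longleftrightarrow> \<omega> \<in> B'"
    and X: "integrable M X" and h: "h \<in> borel_measurable G" "integrable M h"
    and le: "AE \<omega> in M. real_cond_exp M F X \<omega> \<le> h \<omega>"
  shows "AE \<omega> in M. real_cond_exp M G X \<omega> \<le> h \<omega>"
proof -
  interpret F: sigma_finite_subalgebra M F
    using prob_space_sigma_finite_subalgebra assms by blast
  interpret G: sigma_finite_subalgebra M G
    using prob_space_sigma_finite_subalgebra assms by blast
  define p where "p = real_cond_exp M G X"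
  define q where "q = real_cond_exp M F X"
  have p: "p \<in> borel_measurable G" "integrable M p"
    using X by (auto simp: p_def G.real_cond_exp_int)
  have q: "integrable M q"
    using X by (auto simp: q_def F.real_cond_exp_int)
  define B where "B = {\<omega> \<in> space M. h \<omega> < p \<omega>}"
  have "{\<omega> \<in> space G. h \<omega> < p \<omega>} \<in> sets G"
    using p(1) h(1) by measurable
  then have BG: "B \<in> sets G"
    using G by (simp add: B_def subalgebra_def)
  then have BM: "B \<in> sets M"
    using G by (auto simp: subalgebra_def)
  obtain B' where B': "B' \<in> sets F" "AE \<omega> in M. \<omega> \<in> B \<longleftrightarrow> \<omega> \<in> B'"
    using GF[OF BG] by blast
  then have B'M: "B' \<in> sets M"
    using F by (auto simp: subalgebra_def)
  \<comment> \<open>The averaging property of conditional expectations is used on \<open>B\<close>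
    for \<open>G\<close> and on \<open>B'\<close> for \<open>F\<close>; the two sets differ by a
    null set, so the integrals agree.\<close>
  have "(\<integral>\<omega>\<in>B. p \<omega> \<partial>M) = (\<integral>\<omega>\<in>B. X \<omega> \<partial>M)"
    unfolding p_def using G.real_cond_exp_intA[OF X BG] by simp
  also have "\<dots> = (\<integral>\<omega>\<in>B'. X \<omega> \<partial>M)"
    using X BM B'M B'(2) unfolding set_lebesgue_integral_def
    by (intro integral_cong_AE) (auto simp: indicator_def)
  also have "\<dots> = (\<integral>\<omega>\<in>B'. q \<omega> \<partial>M)"
    unfolding q_def using F.real_cond_exp_intA[OF X B'(1)] by simp
  also have "\<dots> = (\<integral>\<omega>\<in>B. q \<omega> \<partial>M)"
    using q BM B'M B'(2) unfolding set_lebesgue_integral_def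
    by (intro integral_cong_AE) (auto simp: indicator_def)
  also have "\<dots> \<le> (\<integral>\<omega>\<in>B. h \<omega> \<partial>M)"
    using q h BM le unfolding set_lebesgue_integral_def q_def
    by (intro integral_mono_AE integrable_mult_indicator) (auto simp: indicator_def)
  finally have "(\<integral>\<omega>\<in>B. p \<omega> \<partial>M) \<le> (\<integral>\<omega>\<in>B. h \<omega> \<partial>M)" .
  \<comment> \<open>By the choice of \<open>B\<close> this integrand is nonnegative, so it vanishes
    almost everywhere and \<open>B\<close> is null.\<close>
  then have "(\<integral>\<omega>. indicator B \<omega> *\<^sub>R (p \<omega> - h \<omega>) \<partial>M) \<le> 0"
    unfolding set_lebesgue_integral_def scaleR_diff_right
    by (subst Bochner_Integration.integral_diff) (auto intro: integrable_mult_indicator[OF BM] simp del: real_scaleR_def simp: p h)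
  moreover have nonneg: "0 \<le> indicator B \<omega> *\<^sub>R (p \<omega> - h \<omega>)" for \<omega>
    by (auto simp: B_def indicator_def)
  moreover have int: "integrable M (\<lambda>\<omega>. indicator B \<omega> *\<^sub>R (p \<omega> - h \<omega>))"
    using p(2) h(2) BM by (intro integrable_mult_indicator) auto
  ultimately have "(\<integral>\<omega>. indicator B \<omega> *\<^sub>R (p \<omega> - h \<omega>) \<partial>M) = 0"
    by (intro antisym integral_nonneg) auto
  then have "AE \<omega> in M. indicator B \<omega> *\<^sub>R (p \<omega> - h \<omega>) = 0"
    using integral_nonneg_eq_0_iff_AE[OF int] nonneg by auto
  then show ?thesis
  proof (rule AE_mp, intro AE_I2 impI)
    fix \<omega> assume "\<omega> \<in> space M" and z: "indicator B \<omega> *\<^sub>R (p \<omega> - h \<omega>) = 0"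
    show "real_cond_exp M G X \<omega> \<le> h \<omega>"
    proof (rule ccontr)
      assume "\<not> ?thesis"
      then have "\<omega> \<in> B" "h \<omega> < p \<omega>"
        using \<open>\<omega> \<in> space M\<close> by (auto simp: B_def p_def)
      with z show False by simp
    qed
  qed
qed

text \<open>\<open>real_cond_exp\<close> is a difference of two nonnegative conditional expectations
  taken back to the reals. For an indicator the subtracted one is 0 and the other is at most 1, so
  nothing is lost. The extended version can then be integrated against a total mass of possibly
  infinite mean.\<close>

lemma nn_cond_exp_indicator_eq:
  assumes "prob_space M" and F: "subalgebra M F" and B: "B \<in> sets M"
  shows "AE \<omega> in M. nn_cond_exp M F (indicator B) \<omega> = ennreal (real_cond_exp M F (indicator B) \<omega>)"
proof -
  interpret F: sigma_finite_subalgebra M F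
    using prob_space_sigma_finite_subalgebra assms by blast
  have "AE \<omega> in M. (0 :: ennreal) = nn_cond_exp M F (\<lambda>_. 0) \<omega>"
    by (rule F.nn_cond_exp_F_meas) simp
  moreover have "AE \<omega> in M. (1 :: ennreal) = nn_cond_exp M F (\<lambda>_. 1) \<omega>"
    by (rule F.nn_cond_exp_F_meas) simp
  moreover have "AE \<omega> in M. nn_cond_exp M F (indicator B) \<omega> \<le> nn_cond_exp M F (\<lambda>_. 1) \<omega>"
    using B by (intro F.nn_cond_exp_mono) (auto simp: indicator_def)
  ultimately show ?thesis
  proof eventually_elim
    case (elim \<omega>)
    have *: "(\<lambda>x. ennreal (- indicator B x)) = (\<lambda>_. 0)" "(\<lambda>x. ennreal (indicator B x)) = indicator B"
      by (auto simp: fun_eq_iff ennreal_neg indicator_def)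
    have "nn_cond_exp M F (indicator B) \<omega> < top"
      using elim by (metis ennreal_one_less_top order_le_less_trans)
    then show ?case
      using elim(1) by (simp add: real_cond_exp_def * flip: elim(1))
  qed
qed

section \<open>Functionals of random measures\<close>

lemma space_measure_algebra: "space (measure_algebra S) = {m. sets m = sets S}"
  unfolding measure_algebra_def by (subst space_Sup_eq_UN) (auto intro: sets.top)

lemma emeasure_measurable_measure_algebra:
  assumes "B \<in> sets S"
  shows "(\<lambda>m. emeasure m B) \<in> measure_algebra S \<rightarrow>\<^sub>M borel"
  unfolding measure_algebra_def
  by (rule measurable_Sup1[OF imageI[OF assms]]) (auto intro!: measurable_vimage_algebra1)

lemma measurable_measure_algebra:
  assumes "\<And>\<omega>. \<omega> \<in> space N \<Longrightarrow> sets (f \<omega>) = sets S"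
    and "\<And>B. B \<in> sets S \<Longrightarrow> (\<lambda>\<omega>. emeasure (f \<omega>) B) \<in> borel_measurable N"
  shows "f \<in> N \<rightarrow>\<^sub>M measure_algebra S"
  unfolding measure_algebra_def
  using assms by (intro measurable_Sup2) (auto intro!: measurable_vimage_algebra2)

lemma emeasure_measurable_random_measure:
  assumes "\<xi> \<in> N \<rightarrow>\<^sub>M measure_algebra S" "B \<in> sets S"
  shows "(\<lambda>\<omega>. emeasure (\<xi> \<omega>) B) \<in> borel_measurable N"
  using measurable_compose[OF assms(1) emeasure_measurable_measure_algebra[OF assms(2)]] .

lemma random_measure_sets:
  assumes "\<xi> \<in> N \<rightarrow>\<^sub>M measure_algebra S" "\<omega> \<in> space N"
  shows "sets (\<xi> \<omega>) = sets S" "space (\<xi> \<omega>) = space S"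
proof -
  show "sets (\<xi> \<omega>) = sets S"
    using measurable_space[OF assms] by (simp add: space_measure_algebra)
  then show "space (\<xi> \<omega>) = space S"
    by (rule sets_eq_imp_space_eq)
qed

section \<open>Integration against a sum of point masses\<close>

lemma sets_point_mass_sum [simp]: "sets (point_mass_sum w u) = sets borel"
  by (simp add: point_mass_sum_def sets_measure_of sets.sigma_sets_eq[of borel, simplified])

text \<open>As the image of a weighted counting measure on the indices, the measure turns integrals
  into series.\<close>

lemma point_mass_sum_eq_distr:
  "point_mass_sum w u = distr (density (count_space UNIV) (\<lambda>k. ennreal (w k))) borel u"
proof (rule measure_eqI)
  fix B assume "B \<in> sets (point_mass_sum w u)"
  then have B: "B \<in> sets borel" by simp
  then show "emeasure (point_mass_sum w u) B
      = emeasure (distr (density (count_space UNIV) (\<lambda>k. ennreal (w k))) borel u) B"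
    by (subst emeasure_distr)
       (simp_all add: emeasure_point_mass_sum emeasure_density nn_integral_count_space_nat indicator_def)
qed simp

lemma nn_integral_point_mass_sum:
  assumes "f \<in> borel_measurable borel"
  shows "(\<integral>\<^sup>+x. f x \<partial>point_mass_sum w u) = (\<Sum>k. ennreal (w k) * f (u k))"
  using assms unfolding point_mass_sum_eq_distr
  by (simp add: nn_integral_distr nn_integral_density nn_integral_count_space_nat)

lemma point_mass_sum_measurable:
  assumes [measurable]: "\<And>k. W k \<in> borel_measurable N" "\<And>k. U k \<in> N \<rightarrow>\<^sub>M borel"
  shows "(\<lambda>\<omega>. point_mass_sum (\<lambda>k. W k \<omega>) (\<lambda>k. U k \<omega>)) \<in> N \<rightarrow>\<^sub>M measure_algebra borel"
  by (rule measurable_measure_algebra) (simp_all add: emeasure_point_mass_sum)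

text \<open>Normalising by the total mass makes the kernel results for sub-probability measures applicable.\<close>

lemma nn_integral_atoms_measurable:
  fixes \<xi> :: "'a \<Rightarrow> 'u::{second_countable_topology, t2_space} measure"
  assumes \<xi>: "\<xi> \<in> N \<rightarrow>\<^sub>M measure_algebra borel" and f[measurable]: "f \<in> borel_measurable borel"
  obtains H where "H \<in> borel_measurable N"
    and "\<And>\<omega>. \<omega> \<in> space N \<Longrightarrow> 0 < emeasure (\<xi> \<omega>) UNIV \<Longrightarrow> emeasure (\<xi> \<omega>) UNIV < \<infinity> \<Longrightarrow>
      H \<omega> = (\<integral>\<^sup>+x. f (emeasure (\<xi> \<omega>) {x}) \<partial>\<xi> \<omega>)"
    and "\<And>\<omega>. \<omega> \<in> space N \<Longrightarrow> 0 < emeasure (\<xi> \<omega>) UNIV \<Longrightarrow> emeasure (\<xi> \<omega>) UNIV < \<infinity> \<Longrightarrow>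
      (\<lambda>x. f (emeasure (\<xi> \<omega>) {x})) \<in> borel_measurable borel"
proof -
  define e where "e \<omega> = emeasure (\<xi> \<omega>) UNIV" for \<omega>
  define K where "K \<omega> = scale_measure (inverse (e \<omega>)) (\<xi> \<omega>)" for \<omega>
  have e[measurable]: "e \<in> borel_measurable N"
    unfolding e_def by (rule emeasure_measurable_random_measure[OF \<xi>]) simp
  have K[measurable]: "K \<in> N \<rightarrow>\<^sub>M subprob_algebra borel"
  proof (rule measurable_subprob_algebra)
    fix \<omega> assume "\<omega> \<in> space N"
    note sets = random_measure_sets[OF \<xi> this]
    show "sets (K \<omega>) = sets borel"
      by (simp add: K_def sets)
    \<comment> \<open>In the degenerate cases the product is 0, since \<open>inverse 0 = top\<close>
      meets the factor 0 and \<open>inverse top = 0\<close>; hence \<open>K\<close> is a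
      sub-probability kernel on all of \<open>space N\<close>.\<close>
    have "inverse (e \<omega>) * e \<omega> \<le> 1"
      by (cases "e \<omega> = 0 \<or> e \<omega> = top") (auto simp: ennreal_mult_divide_eq less_top mult.commute divide_ennreal_def[symmetric] ennreal_divide_self)
    then show "subprob_space (K \<omega>)"
      by (intro subprob_spaceI) (simp_all add: K_def space_scale_measure sets e_def)
  next
    fix A :: "'u set" assume "A \<in> sets borel"
    from emeasure_measurable_random_measure[OF \<xi> this]
    show "(\<lambda>\<omega>. emeasure (K \<omega>) A) \<in> borel_measurable N"
      by (simp add: K_def)
  qed
  \<comment> \<open>The singleton \<open>{x}\<close> moves with the integration variable, so joint
    measurability of the diagonal is required: it is closed in a Hausdorff space, and by second
    countability the Borel sets of the square form the product \<sigma>-algebra.\<close>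
  have "closed {p :: 'u \<times> 'u. fst p = snd p}"
    by (intro closed_Collect_eq continuous_intros)
  then have diag: "{p :: 'u \<times> 'u. fst p = snd p} \<in> sets (borel \<Otimes>\<^sub>M borel)"
    unfolding borel_prod by simp
  have [measurable]: "(SIGMA p:space (N \<Otimes>\<^sub>M (borel :: 'u measure)). {snd p}) \<in> sets ((N \<Otimes>\<^sub>M borel) \<Otimes>\<^sub>M borel)"
  proof -
    have "(\<lambda>p. (snd (fst p), snd p)) \<in> (N \<Otimes>\<^sub>M (borel :: 'u measure)) \<Otimes>\<^sub>M (borel :: 'u measure) \<rightarrow>\<^sub>M borel \<Otimes>\<^sub>M borel"
      by measurable
    from measurable_sets[OF this diag] show ?thesis
      by (rule back_subst[of "\<lambda>A. A \<in> _"]) (auto simp: space_pair_measure)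
  qed
  have "(\<lambda>p. emeasure (K (fst p)) {snd p}) \<in> borel_measurable (N \<Otimes>\<^sub>M borel)"
    by (rule emeasure_measurable_subprob_algebra2[where N = borel]) measurable
  then have g[measurable]: "(\<lambda>p. f (e (fst p) * emeasure (K (fst p)) {snd p})) \<in> borel_measurable (N \<Otimes>\<^sub>M borel)"
    by measurable
  \<comment> \<open>The normalisation is undone twice, inside \<open>f\<close> for the masses of the
    atoms and outside for the integrating measure.\<close>
  define H where "H \<omega> = e \<omega> * (\<integral>\<^sup>+x. f (e \<omega> * emeasure (K \<omega>) {x}) \<partial>K \<omega>)" for \<omega>
  have int: "(\<lambda>\<omega>. \<integral>\<^sup>+x. f (e \<omega> * emeasure (K \<omega>) {x}) \<partial>K \<omega>) \<in> borel_measurable N"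
    by (rule nn_integral_measurable_subprob_algebra2[where N = borel])
       (use g in \<open>simp_all add: case_prod_beta' K\<close>)
  show ?thesis
  proof
    show "H \<in> borel_measurable N"
      unfolding H_def using int by measurable
    fix \<omega> assume \<omega>: "\<omega> \<in> space N" and "0 < emeasure (\<xi> \<omega>) UNIV" "emeasure (\<xi> \<omega>) UNIV < \<infinity>"
    note sets = random_measure_sets[OF \<xi> \<omega>]
    have "e \<omega> * inverse (e \<omega>) = 1"
      using \<open>0 < _\<close> \<open>_ < \<infinity>\<close> by (simp add: e_def divide_ennreal_def[symmetric] ennreal_divide_self)
    then have cancel: "e \<omega> * (inverse (e \<omega>) * x) = x" for x
      by (simp add: mult.assoc[symmetric])
    then have atoms: "e \<omega> * emeasure (K \<omega>) {x} = emeasure (\<xi> \<omega>) {x}" for x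
      by (simp add: K_def)
    have "(\<lambda>x. f (e \<omega> * emeasure (K \<omega>) {x})) \<in> borel_measurable borel"
      using measurable_compose[OF measurable_Pair1'[OF \<omega>] g] by simp
    then show meas: "(\<lambda>x. f (emeasure (\<xi> \<omega>) {x})) \<in> borel_measurable borel"
      by (simp add: atoms)
    then have "(\<lambda>x. f (emeasure (\<xi> \<omega>) {x})) \<in> borel_measurable (\<xi> \<omega>)"
      using sets measurable_cong_sets by blast
    then show "H \<omega> = (\<integral>\<^sup>+x. f (emeasure (\<xi> \<omega>) {x}) \<partial>\<xi> \<omega>)"
      unfolding H_def atoms by (simp add: K_def nn_integral_scale_measure cancel)
  qed
qed

lemma subalgebra_vimage_algebra:
  assumes "f \<in> M \<rightarrow>\<^sub>M N"
  shows "subalgebra M (vimage_algebra (space M) f N)"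
  using measurable_sets[OF assms] measurable_space[OF assms]
  by (subst subalgebra_def) (auto simp: sets_vimage_algebra2 Pi_iff)

section \<open>Conditional law of a row sum\<close>

lemma row_sum_eq_partial:
  assumes "\<And>k. N \<le> k \<Longrightarrow> \<not> Z i k \<omega>"
  shows "row_sum Z i \<omega> = (\<Sum>k<N. of_bool (Z i k \<omega>))"
  unfolding row_sum_def by (rule suminf_finite) (use assms in \<open>auto simp: not_less\<close>)

lemma poisson_weight_tendsto:
  assumes "t \<longlonglongrightarrow> t'"
  shows "(\<lambda>N. poisson_weight (t N) A) \<longlonglongrightarrow> poisson_weight t' A"
  unfolding poisson_weight_def by (intro tendsto_intros assms) simp

text \<open>Given the atoms, the row consists of independent Bernoulli variables. For each
  \<open>N\<close> the product estimate bounds an event containing the one in question, and letting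
  \<open>N\<close> tend to infinity removes the tail.\<close>

lemma real_cond_exp_row_sum_le:
  assumes "prob_space M" and Z: "generated_matrix M W U n Z" and i: "i \<in> {1..n}"
    and W: "AE \<omega> in M. (\<forall>k. W k \<omega> \<in> {0..1}) \<and> summable (\<lambda>k. W k \<omega>)"
    and row: "row_sum Z i \<in> M \<rightarrow>\<^sub>M count_space UNIV" and "finite A"
  shows "AE \<omega> in M. real_cond_exp M (sigma_atoms M W U) (indicator (row_sum Z i -` A \<inter> space M)) \<omega>
    \<le> poisson_weight (\<Sum>k. W k \<omega>) A + (\<Sum>k. le_cam_gap (W k \<omega>))"
proof -
  interpret prob_space M by fact
  let ?I = "{1..n} \<times> (UNIV :: nat set)"
  let ?C = "\<Pi>\<^sub>M p\<in>?I. count_space (UNIV :: bool set)"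
  define F where "F = sigma_atoms M W U"
  define Y where "Y \<omega> = (\<lambda>(i, k)\<in>?I. Z i k \<omega>)" for \<omega>
  have I: "{i} \<times> UNIV \<subseteq> ?I"
    using i by auto
  have sub: "subalgebra M F" and Y: "Y \<in> M \<rightarrow>\<^sub>M ?C"
    and law: "\<And>B. B \<in> sets ?C \<Longrightarrow> AE \<omega> in M. real_cond_exp M F (indicator (Y -` B \<inter> space M)) \<omega>
        = measure (bernoulli_product ?I (\<lambda>k. W k \<omega>)) B"
    using Z unfolding generated_matrix_def regular_cond_law_def F_def Y_def by auto
  interpret F: sigma_finite_subalgebra M F
    using prob_space_sigma_finite_subalgebra[OF \<open>prob_space M\<close> sub] .
  define B where "B N = {z \<in> space ?C. partial_row_sum i N z \<in> A \<or> (\<exists>k\<ge>N. z (i, k))}" for N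
  have B: "B N \<in> sets ?C" for N
  proof -
    have "(i, k) \<in> ?I" for k
      using i by auto
    then have [measurable]: "(\<lambda>z. z (i, k)) \<in> ?C \<rightarrow>\<^sub>M count_space UNIV" for k
      by (rule measurable_component_singleton)
    have "partial_row_sum i N \<in> ?C \<rightarrow>\<^sub>M count_space UNIV"
      by measurable
    from measurable_sets[OF this, of A] have "{z \<in> space ?C. partial_row_sum i N z \<in> A} \<in> sets ?C"
      by (simp add: vimage_def Int_def conj_commute)
    moreover have "{z \<in> space ?C. \<exists>k\<ge>N. z (i, k)} \<in> sets ?C"
      by measurable
    ultimately have "{z \<in> space ?C. partial_row_sum i N z \<in> A} \<union> {z \<in> space ?C. \<exists>k\<ge>N. z (i, k)} \<in> sets ?C"
      by (rule sets.Un)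
    also have "{z \<in> space ?C. partial_row_sum i N z \<in> A} \<union> {z \<in> space ?C. \<exists>k\<ge>N. z (i, k)} = B N"
      unfolding B_def by blast
    finally show ?thesis .
  qed
  have space: "space (bernoulli_product ?I w) = space ?C" for w
    using sets_eq_imp_space_eq[OF sets_bernoulli_product] .
  \<comment> \<open>If infinitely many entries are 1, the tail condition holds for every
    \<open>N\<close>, so the inclusion is true whatever default value \<open>row_sum\<close> takes
    there.\<close>
  have row_sub: "row_sum Z i -` A \<inter> space M \<subseteq> Y -` B N \<inter> space M" for N
  proof
    fix \<omega> assume \<omega>: "\<omega> \<in> row_sum Z i -` A \<inter> space M"
    have Yi: "Y \<omega> (i, k) = Z i k \<omega>" for k
      using i by (simp add: Y_def)
    have "Y \<omega> \<in> space ?C"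
      using measurable_space[OF Y] \<omega> by auto
    moreover have "partial_row_sum i N (Y \<omega>) \<in> A" if "\<not> (\<exists>k\<ge>N. Y \<omega> (i, k))"
      using row_sum_eq_partial[of N Z i \<omega>] that \<omega> by (simp add: Yi)
    ultimately show "\<omega> \<in> Y -` B N \<inter> space M"
      using \<omega> unfolding B_def by blast
  qed
  have "AE \<omega> in M. real_cond_exp M F (indicator (row_sum Z i -` A \<inter> space M)) \<omega>
      \<le> measure (bernoulli_product ?I (\<lambda>k. W k \<omega>)) (B N)" for N
  proof -
    have "AE \<omega> in M. real_cond_exp M F (indicator (row_sum Z i -` A \<inter> space M)) \<omega>
        \<le> real_cond_exp M F (indicator (Y -` B N \<inter> space M)) \<omega>"
    proof (rule F.real_cond_exp_mono)
      show "AE \<omega> in M. indicat_real (row_sum Z i -` A \<inter> space M) \<omega> \<le> indicator (Y -` B N \<inter> space M) \<omega>"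
        using row_sub[of N] by (intro AE_I2) (auto simp: indicator_def)
      show "integrable M (indicat_real (row_sum Z i -` A \<inter> space M))"
        using measurable_sets[OF row, of A] by (simp add: emeasure_eq_measure)
      show "integrable M (indicat_real (Y -` B N \<inter> space M))"
        using measurable_sets[OF Y B] by (simp add: emeasure_eq_measure)
    qed
    with law[OF B[of N]] show ?thesis
      by eventually_elim simp
  qed
  \<comment> \<open>Countably many \<open>N\<close> share one null set, which permits the limit to
    be taken for a fixed \<omega>.\<close>
  then have "AE \<omega> in M. \<forall>N. real_cond_exp M F (indicator (row_sum Z i -` A \<inter> space M)) \<omega>
      \<le> measure (bernoulli_product ?I (\<lambda>k. W k \<omega>)) (B N)"
    by (simp add: AE_all_countable)
  with W show ?thesis
    unfolding F_def[symmetric]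
  proof eventually_elim
    case (elim \<omega>)
    define w where "w k = W k \<omega>" for k
    have w: "\<And>k. w k \<in> {0..1}" "summable w"
      using elim by (auto simp: w_def[abs_def])
    have "summable (\<lambda>k. le_cam_gap (w k))"
      by (rule summable_comparison_test'[OF w(2), of 0]) (use w in \<open>auto simp: le_cam_gap_nonneg le_cam_gap_le\<close>)
    then have gap: "(\<lambda>N. \<Sum>k<N. le_cam_gap (w k)) \<longlonglongrightarrow> (\<Sum>k. le_cam_gap (w k))"
      by (rule summable_LIMSEQ)
    have mass: "(\<lambda>N. \<Sum>k<N. w k) \<longlonglongrightarrow> (\<Sum>k. w k)"
      using w by (intro summable_LIMSEQ)
    have "(\<lambda>N. (\<Sum>k. w k) - (\<Sum>k<N. w k)) \<longlonglongrightarrow> (\<Sum>k. w k) - (\<Sum>k. w k)"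
      by (intro tendsto_intros mass)
    then have tail: "(\<lambda>N. \<Sum>k. w (k + N)) \<longlonglongrightarrow> 0"
      by (simp add: suminf_minus_initial_segment[OF w(2)])
    have lim: "(\<lambda>N. poisson_weight (\<Sum>k<N. w k) A + (\<Sum>k<N. le_cam_gap (w k)) + (\<Sum>k. w (k + N)))
       \<longlonglongrightarrow> poisson_weight (\<Sum>k. w k) A + (\<Sum>k. le_cam_gap (w k)) + 0"
      by (intro tendsto_add poisson_weight_tendsto mass gap tail)
    have "real_cond_exp M F (indicator (row_sum Z i -` A \<inter> space M)) \<omega>
        \<le> poisson_weight (\<Sum>k. w k) A + (\<Sum>k. le_cam_gap (w k)) + 0"
    proof (rule LIMSEQ_le_const[OF lim], intro exI[of _ 0] allI impI)
      fix N
      have "real_cond_exp M F (indicator (row_sum Z i -` A \<inter> space M)) \<omega> \<le> measure (bernoulli_product ?I w) (B N)"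
        using elim by (simp add: w_def[abs_def])
      also have "\<dots> \<le> poisson_weight (\<Sum>k<N. w k) A + (\<Sum>k<N. le_cam_gap (w k)) + (\<Sum>k. w (k + N))"
        using bernoulli_product_row_le[OF I w \<open>finite A\<close>, of N] unfolding space B_def .
      finally show "real_cond_exp M F (indicator (row_sum Z i -` A \<inter> space M)) \<omega>
        \<le> poisson_weight (\<Sum>k<N. w k) A + (\<Sum>k<N. le_cam_gap (w k)) + (\<Sum>k. w (k + N))" .
    qed
    then show ?case
      by (simp add: w_def)
  qed
qed

section \<open>The first size-biased pick\<close>

text \<open>The total mass cancels the denominator in the conditional law of the first pick. For
  indicators this is the defining property at \<open>j = 0\<close>; linearity and monotone limits
  give all nonnegative \<open>g\<close>.\<close>

lemma nn_integral_size_biased_first: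
  fixes g :: "real \<Rightarrow> ennreal"
  assumes "prob_space M" and W[measurable]: "\<And>k. W k \<in> borel_measurable M"
    and W01: "AE \<omega> in M. (\<forall>k. W k \<omega> \<in> {0..1}) \<and> summable (\<lambda>k. W k \<omega>) \<and> 0 < (\<Sum>k. W k \<omega>)"
    and V: "size_biased_permutation M W V"
    and g: "g \<in> borel_measurable borel"
  shows "(\<integral>\<^sup>+\<omega>. (\<Sum>k. ennreal (W k \<omega>)) * g (V 0 \<omega>) \<partial>M) = (\<integral>\<^sup>+\<omega>. (\<Sum>k. ennreal (W k \<omega>) * g (W k \<omega>)) \<partial>M)"
proof -
  interpret prob_space M by fact
  have V0[measurable]: "V 0 \<in> borel_measurable M"
    using V by (simp add: size_biased_permutation_def)
  define F where "F = sigma_picks M W V 0"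
  let ?N = "(\<Pi>\<^sub>M k\<in>(UNIV :: nat set). borel :: real measure) \<Otimes>\<^sub>M (\<Pi>\<^sub>M i\<in>{..<0 :: nat}. borel :: real measure)"
  let ?f = "\<lambda>\<omega>. (\<lambda>k\<in>UNIV. W k \<omega>, \<lambda>i\<in>{..<0 :: nat}. V i \<omega>)"
  have f: "?f \<in> M \<rightarrow>\<^sub>M ?N"
    by (intro measurable_Pair measurable_restrict) auto
  have sub: "subalgebra M F"
    unfolding F_def sigma_picks_def using f by (rule subalgebra_vimage_algebra)
  have fF: "?f \<in> F \<rightarrow>\<^sub>M ?N"
    unfolding F_def sigma_picks_def using measurable_space[OF f]
    by (intro measurable_vimage_algebra1) auto
  have [measurable]: "W k \<in> borel_measurable F" for k
    using measurable_compose[OF measurable_compose[OF fF measurable_fst] measurable_component_singleton[of k UNIV]]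
    by simp
  interpret F: sigma_finite_subalgebra M F
    using prob_space_sigma_finite_subalgebra[OF \<open>prob_space M\<close> sub] .
  show ?thesis
    using g
  proof (induction g)
    case (cong f g)
    then have "f = g"
      by (intro ext) simp
    with cong.IH show ?case
      by simp
  next
    case (set B)
    then have B: "V 0 -` B \<inter> space M \<in> sets M"
      by simp
    have "(\<integral>\<^sup>+\<omega>. (\<Sum>k. ennreal (W k \<omega>)) * indicator B (V 0 \<omega>) \<partial>M)
        = (\<integral>\<^sup>+\<omega>. (\<Sum>k. ennreal (W k \<omega>)) * indicator (V 0 -` B \<inter> space M) \<omega> \<partial>M)"
      by (intro nn_integral_cong) (simp add: indicator_def)
    \<comment> \<open>The total mass is measurable with respect to \<open>F\<close>, so the other
      factor may be replaced by its conditional expectation.\<close>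
    also have "\<dots> = (\<integral>\<^sup>+\<omega>. (\<Sum>k. ennreal (W k \<omega>)) * nn_cond_exp M F (indicator (V 0 -` B \<inter> space M)) \<omega> \<partial>M)"
      using B by (intro F.nn_cond_exp_intg[symmetric]) auto
    also have "\<dots> = (\<integral>\<^sup>+\<omega>. (\<Sum>k. ennreal (W k \<omega>) * indicator B (W k \<omega>)) \<partial>M)"
    proof (rule nn_integral_cong_AE)
      \<comment> \<open>Before any pick the sums over \<open>i < 0\<close> are empty, so
        \<open>R\<close> is the total mass; it is positive almost surely and the first branch
        applies.\<close>
      have "AE \<omega> in M. let R = (\<Sum>k. W k \<omega>) - (\<Sum>i<0. V i \<omega>) in
         if R > 0 then real_cond_exp M F (indicator (V 0 -` B \<inter> space M)) \<omega> =
             ((\<Sum>k. W k \<omega> * indicator B (W k \<omega>)) - (\<Sum>i<0. V i \<omega> * indicator B (V i \<omega>))) / R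
         else V 0 \<omega> = 0"
        unfolding F_def
        by (rule V[unfolded size_biased_permutation_def, THEN conjunct2, THEN spec[of _ 0], THEN bspec, OF set])
      with W01 nn_cond_exp_indicator_eq[OF \<open>prob_space M\<close> sub B]
      show "AE \<omega> in M. (\<Sum>k. ennreal (W k \<omega>)) * nn_cond_exp M F (indicator (V 0 -` B \<inter> space M)) \<omega>
          = (\<Sum>k. ennreal (W k \<omega>) * indicator B (W k \<omega>))"
      proof eventually_elim
        case (elim \<omega>)
        define R where "R = (\<Sum>k. W k \<omega>)"
        define S where "S = (\<Sum>k. W k \<omega> * indicator B (W k \<omega>))"
        have R: "0 < R" "(\<Sum>k. ennreal (W k \<omega>)) = ennreal R"
          using elim(1) by (auto simp: R_def intro!: suminf_ennreal2)
        have summ: "summable (\<lambda>k. W k \<omega> * indicator B (W k \<omega>))"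
          by (rule summable_comparison_test'[of "\<lambda>k. W k \<omega>" 0]) (use elim(1) in \<open>auto simp: indicator_def\<close>)
        have "(\<Sum>k. ennreal (W k \<omega>) * indicator B (W k \<omega>)) = (\<Sum>k. ennreal (W k \<omega> * indicator B (W k \<omega>)))"
          by (intro suminf_cong) (simp add: indicator_def)
        also have "\<dots> = ennreal S"
          unfolding S_def using elim(1) summ by (intro suminf_ennreal2) auto
        finally have S: "(\<Sum>k. ennreal (W k \<omega>) * indicator B (W k \<omega>)) = ennreal S" .
        have "nn_cond_exp M F (indicator (V 0 -` B \<inter> space M)) \<omega> = ennreal (S / R)"
          using elim R(1) by (simp add: R_def S_def)
        then show ?case
          unfolding R S using R(1) by (simp flip: ennreal_mult')
      qed
    qed
    finally show ?case .
  next
    case (mult u c)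
    note [measurable] = mult.hyps(2)
    have "(\<integral>\<^sup>+\<omega>. (\<Sum>k. ennreal (W k \<omega>)) * (c * u (V 0 \<omega>)) \<partial>M) = c * (\<integral>\<^sup>+\<omega>. (\<Sum>k. ennreal (W k \<omega>)) * u (V 0 \<omega>) \<partial>M)"
      by (subst nn_integral_cmult[symmetric]) (auto simp: ac_simps)
    also have "\<dots> = c * (\<integral>\<^sup>+\<omega>. (\<Sum>k. ennreal (W k \<omega>) * u (W k \<omega>)) \<partial>M)"
      using mult.IH by simp
    also have "\<dots> = (\<integral>\<^sup>+\<omega>. c * (\<Sum>k. ennreal (W k \<omega>) * u (W k \<omega>)) \<partial>M)"
      by (subst nn_integral_cmult[symmetric]) auto
    also have "\<dots> = (\<integral>\<^sup>+\<omega>. (\<Sum>k. ennreal (W k \<omega>) * (c * u (W k \<omega>))) \<partial>M)"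
      by (subst ennreal_suminf_cmult[symmetric]) (simp add: ac_simps)
    finally show ?case .
  next
    case (add u v)
    note [measurable] = add.hyps(1,3)
    show ?case
      by (simp add: ring_distribs nn_integral_add add.IH suminf_add[symmetric])
  next
    case (seq Q)
    note [measurable] = seq.hyps(1)
    have inc: "incseq (\<lambda>j. Q j x)" for x
      using seq.hyps by (auto simp: incseq_def le_fun_def)
    have "(\<integral>\<^sup>+\<omega>. (\<Sum>k. ennreal (W k \<omega>)) * (SUP j. Q j) (V 0 \<omega>) \<partial>M)
        = (\<integral>\<^sup>+\<omega>. (SUP j. (\<Sum>k. ennreal (W k \<omega>)) * Q j (V 0 \<omega>)) \<partial>M)"
      by (simp add: SUP_mult_left_ennreal image_comp)
    also have "\<dots> = (SUP j. \<integral>\<^sup>+\<omega>. (\<Sum>k. ennreal (W k \<omega>)) * Q j (V 0 \<omega>) \<partial>M)"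
      using inc by (intro nn_integral_monotone_convergence_SUP) (auto simp: incseq_def le_fun_def intro!: mult_left_mono)
    also have "\<dots> = (SUP j. \<integral>\<^sup>+\<omega>. (\<Sum>k. ennreal (W k \<omega>) * Q j (W k \<omega>)) \<partial>M)"
      using seq.IH by simp
    also have "\<dots> = (\<integral>\<^sup>+\<omega>. (SUP j. \<Sum>k. ennreal (W k \<omega>) * Q j (W k \<omega>)) \<partial>M)"
      using inc by (intro nn_integral_monotone_convergence_SUP[symmetric])
        (auto simp: incseq_def le_fun_def intro!: mult_left_mono suminf_le)
    also have "\<dots> = (\<integral>\<^sup>+\<omega>. (\<Sum>k. SUP j. ennreal (W k \<omega>) * Q j (W k \<omega>)) \<partial>M)"
      using inc by (intro nn_integral_cong ennreal_suminf_SUP_eq[symmetric])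
        (auto simp: incseq_def intro!: mult_left_mono)
    also have "\<dots> = (\<integral>\<^sup>+\<omega>. (\<Sum>k. ennreal (W k \<omega>) * (SUP j. Q j) (W k \<omega>)) \<partial>M)"
      by (simp add: SUP_mult_left_ennreal image_comp)
    finally show ?case .
  qed
qed

section \<open>Conditioning on the random measure\<close>

text \<open>The same target set is pulled back along the \<open>F\<close>-measurable version; this
  supplies the containment up to null sets needed for
  \<open>cond_exp_upper_bound_transfer\<close>.\<close>

lemma vimage_algebra_AE_eq:
  assumes \<xi>: "\<xi> \<in> M \<rightarrow>\<^sub>M N" and \<xi>': "\<xi>' \<in> F \<rightarrow>\<^sub>M N" and F: "subalgebra M F"
    and eq: "AE \<omega> in M. \<xi> \<omega> = \<xi>' \<omega>" and B: "B \<in> sets (vimage_algebra (space M) \<xi> N)"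
  shows "\<exists>B'\<in>sets F. AE \<omega> in M. \<omega> \<in> B \<longleftrightarrow> \<omega> \<in> B'"
proof -
  obtain C where C: "C \<in> sets N" "B = \<xi> -` C \<inter> space M"
    using B measurable_space[OF \<xi>] by (auto simp: sets_vimage_algebra2 Pi_iff)
  have "\<xi>' -` C \<inter> space F \<in> sets F"
    using \<xi>' C(1) by (rule measurable_sets)
  moreover have "AE \<omega> in M. \<omega> \<in> B \<longleftrightarrow> \<omega> \<in> \<xi>' -` C \<inter> space F"
    using eq AE_space by eventually_elim (use F C(2) in \<open>auto simp: subalgebra_def\<close>)
  ultimately show ?thesis
    by blast
qed

section \<open>Weights, total mass and total gap of a unitary random measure\<close>

lemma point_mass_sum_total:
  assumes w: "\<And>k. w k \<in> {0..1}" and fin: "emeasure (point_mass_sum w u) UNIV < \<infinity>"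
    and pos: "0 < emeasure (point_mass_sum w u) UNIV"
  shows "summable w" "0 < (\<Sum>k. w k)" "total_mass (point_mass_sum w u) = (\<Sum>k. w k)"
proof -
  have e: "emeasure (point_mass_sum w u) UNIV = (\<Sum>k. ennreal (w k))"
    by (simp add: emeasure_point_mass_sum)
  show s: "summable w"
    using fin w unfolding e by (intro summable_suminf_not_top) (auto simp: less_top)
  have e': "emeasure (point_mass_sum w u) UNIV = ennreal (\<Sum>k. w k)"
    unfolding e using s w by (intro suminf_ennreal2) auto
  show "0 < (\<Sum>k. w k)"
    using pos unfolding e' by simp
  have "space (point_mass_sum w u) = UNIV"
    using sets_eq_imp_space_eq[OF sets_point_mass_sum] by simp
  then show "total_mass (point_mass_sum w u) = (\<Sum>k. w k)"
    using e' s w by (simp add: total_mass_def measure_def suminf_nonneg)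
qed

lemma unitary_random_measure_weights:
  assumes "unitary_random_measure M \<xi> W U"
  shows "AE \<omega> in M. ((\<forall>k. W k \<omega> \<in> {0..1}) \<and> summable (\<lambda>k. W k \<omega>) \<and> 0 < (\<Sum>k. W k \<omega>))
    \<and> total_mass (\<xi> \<omega>) = (\<Sum>k. W k \<omega>)"
proof -
  have "AE \<omega> in M. \<xi> \<omega> = point_mass_sum (\<lambda>k. W k \<omega>) (\<lambda>k. U k \<omega>)"
    "AE \<omega> in M. \<forall>k. W k \<omega> \<in> {0..1}"
    "AE \<omega> in M. emeasure (\<xi> \<omega>) UNIV < \<infinity>" "AE \<omega> in M. 0 < emeasure (\<xi> \<omega>) UNIV"
    using assms unfolding unitary_random_measure_def by auto
  then show ?thesis
  proof eventually_elim
    case (elim \<omega>)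
    then show ?case
      using point_mass_sum_total[of "\<lambda>k. W k \<omega>" "\<lambda>k. U k \<omega>"] by auto
  qed
qed

lemma summable_le_cam_gap:
  assumes "\<And>k. w k \<in> {0..1}" "summable w"
  shows "summable (\<lambda>k. le_cam_gap (w k))" "summable (\<lambda>k. (w k)\<^sup>2)"
  using assms
  by (auto intro!: summable_comparison_test'[OF assms(2), of 0]
      simp: le_cam_gap_nonneg le_cam_gap_le power2_eq_square mult_left_le)

text \<open>A positive total forces some positive weight, and a single strict term suffices.\<close>

lemma suminf_le_cam_gap_less:
  assumes w: "\<And>k. w k \<in> {0..1}" "summable w" and pos: "0 < (\<Sum>k. w k)"
  shows "(\<Sum>k. le_cam_gap (w k)) < (\<Sum>k. (w k)\<^sup>2)"
proof -
  have "\<exists>k. 0 < w k"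
    using suminf_pos_iff[OF w(2)] w pos by auto
  then obtain k where "0 < w k" ..
  note summable = summable_le_cam_gap[OF w]
  have "0 < (\<Sum>k. (w k)\<^sup>2 - le_cam_gap (w k))"
    using le_cam_gap_less_square[OF \<open>0 < w k\<close>] w
    by (intro suminf_pos2[of _ k] summable_diff summable) (auto intro!: le_cam_gap_le_square)
  then show ?thesis
    by (simp add: suminf_diff[OF summable(2,1), symmetric])
qed

text \<open>With distinct locations the mass of \<open>{u k}\<close> is exactly \<open>w k\<close>
  whenever \<open>w k > 0\<close>. An index of weight 0 contributes 0 wherever its location is, as
  the weight multiplies the integrand.\<close>

lemma nn_integral_atoms_point_mass_sum:
  fixes u :: "nat \<Rightarrow> 'u::t2_space"
  assumes w: "\<And>k. w k \<in> {0..1}" "summable w"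
    and distinct: "\<And>j k. j \<noteq> k \<Longrightarrow> 0 < w j \<Longrightarrow> 0 < w k \<Longrightarrow> u j \<noteq> u k"
    and meas: "(\<lambda>x. ennreal (1 - exp (- enn2real (emeasure (point_mass_sum w u) {x})))) \<in> borel_measurable borel"
  shows "(\<integral>\<^sup>+x. ennreal (1 - exp (- enn2real (emeasure (point_mass_sum w u) {x}))) \<partial>point_mass_sum w u)
     = ennreal (\<Sum>k. le_cam_gap (w k))"
proof -
  have atom: "emeasure (point_mass_sum w u) {u k} = ennreal (w k)" if "0 < w k" for k
  proof -
    have "emeasure (point_mass_sum w u) {u k} = (\<Sum>j. ennreal (w j) * indicator {u k} (u j))"
      by (simp add: emeasure_point_mass_sum)
    also have "\<dots> = (\<Sum>j\<in>{k}. ennreal (w j) * indicator {u k} (u j))"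
    proof (rule suminf_finite)
      fix j assume "j \<notin> {k}"
      then show "ennreal (w j) * indicator {u k} (u j) = 0"
        using distinct[of j k] that w(1)[of j] by (cases "w j = 0") (auto simp: indicator_def)
    qed simp
    finally show ?thesis by simp
  qed
  have "(\<integral>\<^sup>+x. ennreal (1 - exp (- enn2real (emeasure (point_mass_sum w u) {x}))) \<partial>point_mass_sum w u)
     = (\<Sum>k. ennreal (w k) * ennreal (1 - exp (- enn2real (emeasure (point_mass_sum w u) {u k}))))"
    by (rule nn_integral_point_mass_sum[OF meas])
  also have "\<dots> = (\<Sum>k. ennreal (le_cam_gap (w k)))"
  proof (rule suminf_cong)
    fix k
    show "ennreal (w k) * ennreal (1 - exp (- enn2real (emeasure (point_mass_sum w u) {u k}))) = ennreal (le_cam_gap (w k))"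
      using w(1)[of k] by (cases "w k = 0") (auto simp: atom le_cam_gap_def ennreal_mult)
  qed
  also have "\<dots> = ennreal (\<Sum>k. le_cam_gap (w k))"
    using w by (intro suminf_ennreal2 summable_le_cam_gap le_cam_gap_nonneg) auto
  finally show ?thesis .
qed

section \<open>Measurability with respect to the conditioning \<sigma>-algebra\<close>

lemma sigma_atoms_measurable:
  shows "W k \<in> borel_measurable (sigma_atoms M W U)" "U k \<in> sigma_atoms M W U \<rightarrow>\<^sub>M borel"
proof -
  have "(\<lambda>\<omega>. \<lambda>k\<in>UNIV. (W k \<omega>, U k \<omega>)) \<in> sigma_atoms M W U \<rightarrow>\<^sub>M (\<Pi>\<^sub>M k\<in>UNIV. borel \<Otimes>\<^sub>M borel)"
    unfolding sigma_atoms_def by (intro measurable_vimage_algebra1) (auto simp: space_PiM space_pair_measure)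
  from measurable_compose[OF this measurable_component_singleton[of k]]
  have *: "(\<lambda>\<omega>. (W k \<omega>, U k \<omega>)) \<in> sigma_atoms M W U \<rightarrow>\<^sub>M borel \<Otimes>\<^sub>M borel"
    by simp
  show "W k \<in> borel_measurable (sigma_atoms M W U)" "U k \<in> sigma_atoms M W U \<rightarrow>\<^sub>M borel"
    using measurable_compose[OF * measurable_fst] measurable_compose[OF * measurable_snd] by simp_all
qed

text \<open>Both \<open>T\<close> and the total Le Cam gap are functionals of the measure itself, since the locations
  of its atoms separate the weights; this is what makes the error bound survive conditioning on \<open>\<xi>\<close>
  alone.\<close>

lemma le_cam_bound_measurable:
  fixes \<xi> :: "'a \<Rightarrow> 'u::{second_countable_topology, t2_space} measure"
  assumes \<xi>: "unitary_random_measure M \<xi> W U"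
    and G: "G = sigma_measure M \<xi> \<and>
           (AE \<omega> in M. \<forall>j k. j \<noteq> k \<and> W j \<omega> > 0 \<and> W k \<omega> > 0 \<longrightarrow> U j \<omega> \<noteq> U k \<omega>)
         \<or> G = sigma_atoms M W U"
  obtains t H where "t \<in> borel_measurable G" "H \<in> borel_measurable G"
    "AE \<omega> in M. t \<omega> = (\<Sum>k. W k \<omega>) \<and> H \<omega> = (\<Sum>k. le_cam_gap (W k \<omega>))"
proof -
  have \<xi>_meas: "\<xi> \<in> M \<rightarrow>\<^sub>M measure_algebra borel"
    and \<xi>_eq: "AE \<omega> in M. \<xi> \<omega> = point_mass_sum (\<lambda>k. W k \<omega>) (\<lambda>k. U k \<omega>)"
    and W01: "AE \<omega> in M. \<forall>k. W k \<omega> \<in> {0..1}"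
    and fin: "AE \<omega> in M. emeasure (\<xi> \<omega>) UNIV < \<infinity>" and pos: "AE \<omega> in M. 0 < emeasure (\<xi> \<omega>) UNIV"
    using \<xi> unfolding unitary_random_measure_def by auto
  from G show ?thesis
  proof
    assume G: "G = sigma_atoms M W U"
    have [measurable]: "W k \<in> borel_measurable G" for k
      unfolding G by (rule sigma_atoms_measurable)
    show ?thesis
    proof
      \<comment> \<open>Extended nonnegative series are measurable without a convergence condition;
        almost surely they are finite and agree with the real series.\<close>
      show "(\<lambda>\<omega>. enn2real (\<Sum>k. ennreal (W k \<omega>))) \<in> borel_measurable G"
        by measurable
      show "(\<lambda>\<omega>. enn2real (\<Sum>k. ennreal (le_cam_gap (W k \<omega>)))) \<in> borel_measurable G"
        by measurable
      show "AE \<omega> in M. enn2real (\<Sum>k. ennreal (W k \<omega>)) = (\<Sum>k. W k \<omega>) \<and>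
          enn2real (\<Sum>k. ennreal (le_cam_gap (W k \<omega>))) = (\<Sum>k. le_cam_gap (W k \<omega>))"
        using \<xi>_eq W01 fin pos
      proof eventually_elim
        case (elim \<omega>)
        then have w: "\<And>k. W k \<omega> \<in> {0..1}" "summable (\<lambda>k. W k \<omega>)"
          using point_mass_sum_total(1)[of "\<lambda>k. W k \<omega>" "\<lambda>k. U k \<omega>"] by auto
        have "(\<Sum>k. ennreal (W k \<omega>)) = ennreal (\<Sum>k. W k \<omega>)"
          using w by (intro suminf_ennreal2) auto
        moreover have "(\<Sum>k. ennreal (le_cam_gap (W k \<omega>))) = ennreal (\<Sum>k. le_cam_gap (W k \<omega>))"
          using w by (intro suminf_ennreal2 summable_le_cam_gap le_cam_gap_nonneg) auto
        moreover have "0 \<le> (\<Sum>k. W k \<omega>)" "0 \<le> (\<Sum>k. le_cam_gap (W k \<omega>))"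
          using w by (auto intro!: suminf_nonneg summable_le_cam_gap le_cam_gap_nonneg)
        ultimately show ?case
          by simp
      qed
    qed
  next
    assume "G = sigma_measure M \<xi> \<and>
           (AE \<omega> in M. \<forall>j k. j \<noteq> k \<and> W j \<omega> > 0 \<and> W k \<omega> > 0 \<longrightarrow> U j \<omega> \<noteq> U k \<omega>)"
    then have G: "G = sigma_measure M \<xi>"
      and distinct: "AE \<omega> in M. \<forall>j k. j \<noteq> k \<and> W j \<omega> > 0 \<and> W k \<omega> > 0 \<longrightarrow> U j \<omega> \<noteq> U k \<omega>"
      by auto
    have \<xi>G: "\<xi> \<in> G \<rightarrow>\<^sub>M measure_algebra borel"
      unfolding G sigma_measure_def using measurable_space[OF \<xi>_meas] by (intro measurable_vimage_algebra1) auto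
    have space: "space G = space M"
      by (simp add: G sigma_measure_def)
    \<comment> \<open>An atom of mass \<open>w\<close> contributes \<open>w\<close> times this
      function at \<open>w\<close>, which is its gap.\<close>
    have "(\<lambda>x. ennreal (1 - exp (- enn2real x))) \<in> borel_measurable borel"
      by measurable
    from nn_integral_atoms_measurable[OF \<xi>G this] obtain H where H: "H \<in> borel_measurable G"
      and H_eq: "\<And>\<omega>. \<omega> \<in> space G \<Longrightarrow> 0 < emeasure (\<xi> \<omega>) UNIV \<Longrightarrow> emeasure (\<xi> \<omega>) UNIV < \<infinity> \<Longrightarrow>
          H \<omega> = (\<integral>\<^sup>+x. ennreal (1 - exp (- enn2real (emeasure (\<xi> \<omega>) {x}))) \<partial>\<xi> \<omega>)"
      and meas: "\<And>\<omega>. \<omega> \<in> space G \<Longrightarrow> 0 < emeasure (\<xi> \<omega>) UNIV \<Longrightarrow> emeasure (\<xi> \<omega>) UNIV < \<infinity> \<Longrightarrow>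
          (\<lambda>x. ennreal (1 - exp (- enn2real (emeasure (\<xi> \<omega>) {x})))) \<in> borel_measurable borel"
      by metis
    show ?thesis
    proof
      show "(\<lambda>\<omega>. enn2real (emeasure (\<xi> \<omega>) UNIV)) \<in> borel_measurable G"
        using emeasure_measurable_random_measure[OF \<xi>G, of UNIV] by measurable
      show "(\<lambda>\<omega>. enn2real (H \<omega>)) \<in> borel_measurable G"
        using H by measurable
      show "AE \<omega> in M. enn2real (emeasure (\<xi> \<omega>) UNIV) = (\<Sum>k. W k \<omega>) \<and>
          enn2real (H \<omega>) = (\<Sum>k. le_cam_gap (W k \<omega>))"
        using \<xi>_eq W01 fin pos distinct AE_space
      proof eventually_elim
        case (elim \<omega>)
        let ?w = "\<lambda>k. W k \<omega>" and ?u = "\<lambda>k. U k \<omega>"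
        have w: "\<And>k. ?w k \<in> {0..1}" "summable ?w" "total_mass (\<xi> \<omega>) = (\<Sum>k. ?w k)"
          using elim point_mass_sum_total[of ?w ?u] by auto
        have "H \<omega> = ennreal (\<Sum>k. le_cam_gap (?w k))"
          using H_eq[of \<omega>] meas[of \<omega>] nn_integral_atoms_point_mass_sum[OF w(1,2), of ?u] elim
          by (simp add: space)
        moreover have "0 \<le> (\<Sum>k. le_cam_gap (?w k))"
          using w by (auto intro!: suminf_nonneg summable_le_cam_gap le_cam_gap_nonneg)
        moreover have "enn2real (emeasure (\<xi> \<omega>) UNIV) = total_mass (\<xi> \<omega>)"
          using random_measure_sets(2)[OF \<xi>_meas, of \<omega>] elim by (simp add: total_mass_def measure_def)
        ultimately show ?case
          using w(3) by simp
      qed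
    qed
  qed
qed

section \<open>The conditional error: measurability and upper bound\<close>

lemma tv_dist_poisson_measurable:
  fixes \<kappa> :: "'a \<Rightarrow> nat measure"
  assumes \<kappa>: "\<kappa> \<in> M \<rightarrow>\<^sub>M prob_algebra (count_space UNIV)" and T[measurable]: "T \<in> borel_measurable M"
    and nonneg: "\<And>\<omega>. \<omega> \<in> space M \<Longrightarrow> 0 \<le> T \<omega>"
  shows "(\<lambda>\<omega>. tv_dist (\<kappa> \<omega>) (measure_pmf (poisson_pmf (T \<omega>)))) \<in> borel_measurable M"
proof -
  have K: "prob_space (\<kappa> \<omega>)" "sets (\<kappa> \<omega>) = UNIV" if "\<omega> \<in> space M" for \<omega>
    using measurable_space[OF \<kappa> that] by (auto simp: space_prob_algebra)
  let ?d = "\<lambda>A \<omega>. \<bar>measure (\<kappa> \<omega>) A - measure_pmf.prob (poisson_pmf (T \<omega>)) A\<bar>"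
  have poisson: "(\<lambda>\<omega>. measure_pmf.prob (poisson_pmf (T \<omega>)) A) \<in> borel_measurable M" if "finite A" for A
  proof -
    \<comment> \<open>Rate 0 is split off, where the probability is a constant;
      \<open>measure_poisson_pmf\<close> supplies the explicit formula for positive rates.\<close>
    have "(\<lambda>\<omega>. if 0 < T \<omega> then poisson_weight (T \<omega>) A else measure_pmf.prob (poisson_pmf 0) A) \<in> borel_measurable M"
      unfolding poisson_weight_def by measurable
    then show ?thesis
      by (rule measurable_cong[THEN iffD1, rotated])
        (use nonneg that in \<open>force simp: measure_poisson_pmf\<close>)
  qed
  have "countable {A :: nat set. finite A}"
    by (rule countable_Collect_finite)
  then have "(\<lambda>\<omega>. SUP A\<in>{A. finite A}. ?d A \<omega>) \<in> borel_measurable M"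
  proof (rule borel_measurable_cSUP)
    fix A :: "nat set" assume "A \<in> {A. finite A}"
    moreover have "(\<lambda>\<omega>. measure (\<kappa> \<omega>) A) \<in> borel_measurable M"
      using measurable_compose[OF \<kappa> measurable_measure_prob_algebra[of A]] by simp
    ultimately show "?d A \<in> borel_measurable M"
      using poisson by simp
  next
    fix \<omega> assume "\<omega> \<in> space M"
    then interpret prob_space "\<kappa> \<omega>"
      by (rule K)
    have "?d A \<omega> \<le> 1" for A
      using prob_le_1[of A] measure_pmf.prob_le_1[of "poisson_pmf (T \<omega>)" A]
        measure_nonneg[of "\<kappa> \<omega>" A] measure_nonneg[of "measure_pmf (poisson_pmf (T \<omega>))" A] by linarith
    then show "bdd_above ((\<lambda>A. ?d A \<omega>) ` {A. finite A})"
      by (intro bdd_aboveI2[where M = 1]) auto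
  qed
  then show ?thesis
    by (rule measurable_cong[THEN iffD1, rotated])
      (simp add: tv_dist_eq_finite_SUP K prob_space_measure_pmf)
qed

text \<open>The one-sided bound is proved given the atoms and transferred to \<open>G\<close> for
  each finite set. These sets are countably many, so one null set serves all of them and the total
  variation bound follows pointwise.\<close>

lemma conditional_tv_dist_le:
  fixes \<xi> :: "'a \<Rightarrow> 'u::{second_countable_topology, t2_space} measure"
  assumes "prob_space M" and \<xi>: "unitary_random_measure M \<xi> W U"
    and Z: "generated_matrix M W U n Z" and i: "i \<in> {1..n}"
    and G: "G = sigma_measure M \<xi> \<and>
           (AE \<omega> in M. \<forall>j k. j \<noteq> k \<and> W j \<omega> > 0 \<and> W k \<omega> > 0 \<longrightarrow> U j \<omega> \<noteq> U k \<omega>)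
         \<or> G = sigma_atoms M W U"
    and \<kappa>: "regular_cond_law M G (row_sum Z i) (count_space UNIV) \<kappa>"
  shows "AE \<omega> in M. tv_dist (\<kappa> \<omega>) (measure_pmf (poisson_pmf (\<Sum>k. W k \<omega>))) \<le> (\<Sum>k. le_cam_gap (W k \<omega>))"
proof -
  interpret prob_space M by fact
  have \<xi>_meas: "\<xi> \<in> M \<rightarrow>\<^sub>M measure_algebra borel"
    and \<xi>_eq: "AE \<omega> in M. \<xi> \<omega> = point_mass_sum (\<lambda>k. W k \<omega>) (\<lambda>k. U k \<omega>)"
    using \<xi> unfolding unitary_random_measure_def by auto
  have W: "AE \<omega> in M. (\<forall>k. W k \<omega> \<in> {0..1}) \<and> summable (\<lambda>k. W k \<omega>) \<and> 0 < (\<Sum>k. W k \<omega>)"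
    using unitary_random_measure_weights[OF \<xi>] by eventually_elim simp
  define F where "F = sigma_atoms M W U"
  have F: "subalgebra M F"
    using Z unfolding generated_matrix_def regular_cond_law_def F_def by simp
  have subG: "subalgebra M G" and row: "row_sum Z i \<in> M \<rightarrow>\<^sub>M count_space UNIV"
    and \<kappa>G: "\<kappa> \<in> G \<rightarrow>\<^sub>M prob_algebra (count_space UNIV)"
    and law: "\<And>A. AE \<omega> in M. real_cond_exp M G (indicator (row_sum Z i -` A \<inter> space M)) \<omega> = measure (\<kappa> \<omega>) A"
    using \<kappa> unfolding regular_cond_law_def by auto
  interpret F: sigma_finite_subalgebra M F
    using prob_space_sigma_finite_subalgebra[OF \<open>prob_space M\<close> F] .
  \<comment> \<open>Either \<open>G\<close> is \<open>F\<close>, or it is generated by \<xi>, which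
    almost surely equals the \<open>F\<close>-measurable sum of point masses.\<close>
  have GF: "\<exists>B'\<in>sets F. AE \<omega> in M. \<omega> \<in> B \<longleftrightarrow> \<omega> \<in> B'" if "B \<in> sets G" for B
    using G
  proof
    assume "G = sigma_atoms M W U"
    with that show ?thesis
      unfolding F_def by blast
  next
    assume "G = sigma_measure M \<xi> \<and>
      (AE \<omega> in M. \<forall>j k. j \<noteq> k \<and> W j \<omega> > 0 \<and> W k \<omega> > 0 \<longrightarrow> U j \<omega> \<noteq> U k \<omega>)"
    then have "B \<in> sets (vimage_algebra (space M) \<xi> (measure_algebra borel))"
      using that by (simp add: sigma_measure_def)
    moreover have "(\<lambda>\<omega>. point_mass_sum (\<lambda>k. W k \<omega>) (\<lambda>k. U k \<omega>)) \<in> F \<rightarrow>\<^sub>M measure_algebra borel"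
      unfolding F_def by (intro point_mass_sum_measurable sigma_atoms_measurable)
    ultimately show ?thesis
      using vimage_algebra_AE_eq[OF \<xi>_meas _ F \<xi>_eq] by blast
  qed
  obtain t H where t[measurable]: "t \<in> borel_measurable G" and H[measurable]: "H \<in> borel_measurable G"
    and tH: "AE \<omega> in M. t \<omega> = (\<Sum>k. W k \<omega>) \<and> H \<omega> = (\<Sum>k. le_cam_gap (W k \<omega>))"
    using le_cam_bound_measurable[OF \<xi> G] by blast
  have "AE \<omega> in M. measure (\<kappa> \<omega>) A \<le> poisson_weight (\<Sum>k. W k \<omega>) A + (\<Sum>k. le_cam_gap (W k \<omega>))"
    if A: "finite A" for A
  proof -
    let ?X = "indicat_real (row_sum Z i -` A \<inter> space M)"
    \<comment> \<open>The bound may fail to be integrable, so it is truncated. Truncation at 1 is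
      harmless for a conditional probability; the one at 0 controls \<open>t\<close> and
      \<open>H\<close> on the null set where they may be negative.\<close>
    define h where "h \<omega> = max 0 (min 1 (poisson_weight (t \<omega>) A + H \<omega>))" for \<omega>
    have h: "h \<in> borel_measurable G"
      unfolding h_def poisson_weight_def by measurable
    have X: "integrable M ?X"
      using measurable_sets[OF row, of A] by (simp add: emeasure_eq_measure)
    have "AE \<omega> in M. real_cond_exp M F ?X \<omega> \<le> 1"
      using X by (intro F.real_cond_exp_le_c) (auto simp: indicator_def)
    moreover have "AE \<omega> in M. real_cond_exp M F ?X \<omega> \<le> poisson_weight (\<Sum>k. W k \<omega>) A + (\<Sum>k. le_cam_gap (W k \<omega>))"
      unfolding F_def using W by (intro real_cond_exp_row_sum_le[OF \<open>prob_space M\<close> Z i _ row A]) auto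
    ultimately have "AE \<omega> in M. real_cond_exp M F ?X \<omega> \<le> h \<omega>"
      using tH by eventually_elim (auto simp: h_def)
    moreover have "integrable M h"
      using measurable_from_subalg[OF subG h]
      by (intro integrable_const_bound[where B = 1]) (auto simp: h_def)
    ultimately have "AE \<omega> in M. real_cond_exp M G ?X \<omega> \<le> h \<omega>"
      by (intro cond_exp_upper_bound_transfer[OF \<open>prob_space M\<close> F subG GF X h])
    with law[of A] tH W show ?thesis
    proof eventually_elim
      case (elim \<omega>)
      have "0 \<le> poisson_weight (\<Sum>k. W k \<omega>) A + (\<Sum>k. le_cam_gap (W k \<omega>))"
        using elim
        by (intro add_nonneg_nonneg poisson_weight_nonneg suminf_nonneg summable_le_cam_gap le_cam_gap_nonneg) auto
      then show ?case
        using elim by (simp add: h_def)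
    qed
  qed
  then have "AE \<omega> in M. \<forall>A\<in>{A. finite A}. measure (\<kappa> \<omega>) A
      \<le> poisson_weight (\<Sum>k. W k \<omega>) A + (\<Sum>k. le_cam_gap (W k \<omega>))"
    by (intro AE_ball_countable' countable_Collect_finite) simp
  with W AE_space show ?thesis
  proof eventually_elim
    case (elim \<omega>)
    have "\<kappa> \<omega> \<in> space (prob_algebra (count_space UNIV))"
      using measurable_space[OF \<kappa>G, of \<omega>] elim subG by (simp add: subalgebra_def)
    then have "prob_space (\<kappa> \<omega>)" "sets (\<kappa> \<omega>) = UNIV"
      by (simp_all add: space_prob_algebra)
    then show ?case
      using elim by (intro tv_dist_le_of_one_sided) (auto simp: measure_poisson_pmf prob_space_measure_pmf)
  qed
qed

section \<open>Strict error bounds, pointwise and in the mean\<close>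

theorem proposition6p1:
  fixes M :: "'a measure"
    and \<xi> :: "'a \<Rightarrow> 'u::{second_countable_topology, t2_space} measure"
    and W V :: "nat \<Rightarrow> 'a \<Rightarrow> real" and U :: "nat \<Rightarrow> 'a \<Rightarrow> 'u"
    and Z :: "nat \<Rightarrow> nat \<Rightarrow> 'a \<Rightarrow> bool" and n i :: nat
    and G :: "'a measure" and \<kappa> :: "'a \<Rightarrow> nat measure"
    and T E :: "'a \<Rightarrow> real"
  assumes "prob_space M"
    and "unitary_random_measure M \<xi> W U"
    and "generated_matrix M W U n Z"
    and "i \<in> {1..n}"
    and conditioning: "G = sigma_measure M \<xi> \<and>
           (AE \<omega> in M. \<forall>j k. j \<noteq> k \<and> W j \<omega> > 0 \<and> W k \<omega> > 0 \<longrightarrow> U j \<omega> \<noteq> U k \<omega>)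
         \<or> G = sigma_atoms M W U"
    and "regular_cond_law M G (row_sum Z i) (count_space UNIV) \<kappa>"
    and T: "\<And>\<omega>. T \<omega> = total_mass (\<xi> \<omega>)"
    and E: "\<And>\<omega>. E \<omega> = tv_dist (\<kappa> \<omega>) (measure_pmf (poisson_pmf (T \<omega>)))"
    and "size_biased_permutation M W V"
  shows "(AE \<omega> in M. E \<omega> < (\<Sum>k. (W k \<omega>)\<^sup>2)) \<and>
         E \<in> borel_measurable M \<and>
         (\<integral>\<^sup>+\<omega>. ennreal (E \<omega>) \<partial>M) < (\<integral>\<^sup>+\<omega>. ennreal (T \<omega> * V 0 \<omega>) \<partial>M)"
proof -
  interpret prob_space M by fact
  have \<xi>_meas: "\<xi> \<in> M \<rightarrow>\<^sub>M measure_algebra borel" and W_meas[measurable]: "\<And>k. W k \<in> borel_measurable M"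
    using \<open>unitary_random_measure M \<xi> W U\<close> unfolding unitary_random_measure_def by auto
  have W: "AE \<omega> in M. ((\<forall>k. W k \<omega> \<in> {0..1}) \<and> summable (\<lambda>k. W k \<omega>) \<and> 0 < (\<Sum>k. W k \<omega>)) \<and> T \<omega> = (\<Sum>k. W k \<omega>)"
    unfolding T using \<open>unitary_random_measure M \<xi> W U\<close> by (rule unitary_random_measure_weights)
  have "AE \<omega> in M. tv_dist (\<kappa> \<omega>) (measure_pmf (poisson_pmf (\<Sum>k. W k \<omega>))) \<le> (\<Sum>k. le_cam_gap (W k \<omega>))"
    using assms by (intro conditional_tv_dist_le)
  with W have bound: "AE \<omega> in M. E \<omega> < (\<Sum>k. (W k \<omega>)\<^sup>2)"
  proof eventually_elim
    case (elim \<omega>)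
    then have "E \<omega> \<le> (\<Sum>k. le_cam_gap (W k \<omega>))"
      by (simp add: E)
    also have "\<dots> < (\<Sum>k. (W k \<omega>)\<^sup>2)"
      using elim by (intro suminf_le_cam_gap_less) auto
    finally show ?case .
  qed
  have sub: "subalgebra M G" and \<kappa>G: "\<kappa> \<in> G \<rightarrow>\<^sub>M prob_algebra (count_space UNIV)"
    using \<open>regular_cond_law M G (row_sum Z i) (count_space UNIV) \<kappa>\<close> unfolding regular_cond_law_def by auto
  have \<kappa>: "\<kappa> \<in> M \<rightarrow>\<^sub>M prob_algebra (count_space UNIV)"
    using measurable_from_subalg[OF sub \<kappa>G] .
  have "T \<omega> = enn2real (emeasure (\<xi> \<omega>) UNIV)" if "\<omega> \<in> space M" for \<omega>
    using random_measure_sets(2)[OF \<xi>_meas that] by (simp add: T total_mass_def measure_def)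
  moreover have "(\<lambda>\<omega>. enn2real (emeasure (\<xi> \<omega>) UNIV)) \<in> borel_measurable M"
    using emeasure_measurable_random_measure[OF \<xi>_meas, of UNIV] by measurable
  ultimately have T_meas[measurable]: "T \<in> borel_measurable M"
    by (simp cong: measurable_cong)
  have E_meas[measurable]: "E \<in> borel_measurable M"
    unfolding E[abs_def] by (rule tv_dist_poisson_measurable[OF \<kappa> T_meas]) (simp add: T total_mass_def)
  have V_meas[measurable]: "V 0 \<in> borel_measurable M"
    using \<open>size_biased_permutation M W V\<close> by (simp add: size_biased_permutation_def)
  \<comment> \<open>Nonnegativity of \<open>T\<close> suffices to split the product:
    \<open>ennreal\<close> sends negative values of \<open>V 0\<close> and of the product alike to
    0.\<close>
  have "(\<integral>\<^sup>+\<omega>. ennreal (T \<omega> * V 0 \<omega>) \<partial>M) = (\<integral>\<^sup>+\<omega>. (\<Sum>k. ennreal (W k \<omega>)) * ennreal (V 0 \<omega>) \<partial>M)"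
  proof (rule nn_integral_cong_AE, use W in eventually_elim)
    case (elim \<omega>)
    then have "(\<Sum>k. ennreal (W k \<omega>)) = ennreal (T \<omega>)"
      by (auto intro!: suminf_ennreal2)
    with elim show ?case
      by (simp add: ennreal_mult')
  qed
  also have "\<dots> = (\<integral>\<^sup>+\<omega>. (\<Sum>k. ennreal (W k \<omega>) * ennreal (W k \<omega>)) \<partial>M)"
    using W by (intro nn_integral_size_biased_first[OF \<open>prob_space M\<close> W_meas _ \<open>size_biased_permutation M W V\<close>]) auto
  also have "\<dots> = (\<integral>\<^sup>+\<omega>. ennreal (\<Sum>k. (W k \<omega>)\<^sup>2) \<partial>M)"
  proof (rule nn_integral_cong_AE, use W in eventually_elim)
    case (elim \<omega>)
    then have "(\<Sum>k. ennreal (W k \<omega>) * ennreal (W k \<omega>)) = (\<Sum>k. ennreal ((W k \<omega>)\<^sup>2))"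
      by (intro suminf_cong) (simp add: power2_eq_square ennreal_mult)
    also have "\<dots> = ennreal (\<Sum>k. (W k \<omega>)\<^sup>2)"
      using elim by (intro suminf_ennreal2 summable_le_cam_gap) auto
    finally show ?case .
  qed
  finally have mean: "(\<integral>\<^sup>+\<omega>. ennreal (T \<omega> * V 0 \<omega>) \<partial>M) = (\<integral>\<^sup>+\<omega>. ennreal (\<Sum>k. (W k \<omega>)\<^sup>2) \<partial>M)" .
  have "(\<integral>\<^sup>+\<omega>. ennreal (E \<omega>) \<partial>M) < (\<integral>\<^sup>+\<omega>. ennreal (\<Sum>k. (W k \<omega>)\<^sup>2) \<partial>M)"
  proof (rule nn_integral_less)
    \<comment> \<open>A finite mean error is what lets the strict inequality pass to the integrals,
      whether or not the other mean is finite.\<close>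
    have E_le: "E \<omega> \<le> 1" if "\<omega> \<in> space M" for \<omega>
      using measurable_space[OF \<kappa> that] unfolding E
      by (intro tv_dist_le_1) (auto simp: space_prob_algebra prob_space_measure_pmf)
    have "(\<integral>\<^sup>+\<omega>. ennreal (E \<omega>) \<partial>M) \<le> (\<integral>\<^sup>+\<omega>. 1 \<partial>M)"
      by (intro nn_integral_mono) (simp add: E_le)
    then show "(\<integral>\<^sup>+\<omega>. ennreal (E \<omega>) \<partial>M) \<noteq> \<infinity>"
      by (auto simp: emeasure_space_1 top_unique)
    show "AE \<omega> in M. ennreal (E \<omega>) \<le> ennreal (\<Sum>k. (W k \<omega>)\<^sup>2)"
      using bound by eventually_elim (simp add: ennreal_leI)
    show "\<not> (AE \<omega> in M. ennreal (\<Sum>k. (W k \<omega>)\<^sup>2) \<le> ennreal (E \<omega>))"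
    proof
      assume "AE \<omega> in M. ennreal (\<Sum>k. (W k \<omega>)\<^sup>2) \<le> ennreal (E \<omega>)"
      with bound W have "AE \<omega> in M. False"
      proof eventually_elim
        case (elim \<omega>)
        \<comment> \<open>Positivity matters because \<open>ennreal\<close> identifies all
          nonpositive reals; with it, the comparison of \<open>ennreal\<close> values returns to the
          reals and contradicts \<open>bound\<close>.\<close>
        then have "0 < (\<Sum>k. (W k \<omega>)\<^sup>2)"
          using suminf_le_cam_gap_less[of "\<lambda>k. W k \<omega>"] suminf_nonneg[of "\<lambda>k. le_cam_gap (W k \<omega>)"]
            summable_le_cam_gap[of "\<lambda>k. W k \<omega>"] le_cam_gap_nonneg
          by (auto intro: le_less_trans)
        then show ?case
          using elim by (auto simp: ennreal_le_iff2)
      qed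
      then show False
        by simp
    qed
  qed measurable
  with mean bound E_meas show ?thesis
    by simp
qed

end
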